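(* Let $a>0$, $T>0$ and let $f:\mathbb{R}\to\mathbb{R}$ be a continuous $T$-periodic function with $\int_0^T f(t)\,dt=0$. For every $N\in\mathbb{Z}$ such that $\left|\frac{2N\pi}{T}\right|<1$ there exist at least two solutions, not differing by an integer multiple of $2\pi$, of $$\frac{d}{dt}\left(\frac{\dot x}{\sqrt{1-\dot x^2}}\right)+a\sin x=f(t)$$ such that $x(t+T)=x(t)+2N\pi$ for all $t\in\mathbb{R}$. Moreover, at least one of them is unstable.
   Context: A solution of the equation is a $C^1$ function $x:\mathbb{R}\to\mathbb{R}$ with $|\dot x(t)|<1$ for all $t$, such that $\dot x/\sqrt{1-\dot x^2}$ is $C^1$ and the equation holds. With $q=x$, $p=\dot x/\sqrt{1-\dot x^2}$ the equation is equivalent to the system $\dot q=\frac{p}{\sqrt{1+p^2}}$, $\dot p=-a\sin q+f(t)$, whose solutions are globally defined. Let $(q(t,q_0,p_0),p(t,q_0,p_0))$ be the solution with initial condition $(q_0,p_0)$ at $t=0$, and let $P_N(q_0,p_0)=(q(T,q_0,p_0)-2N\pi,\;p(T,q_0,p_0))$. Solutions with $x(t+T)=x(t)+2N\pi$ for all $t$ ($T$-periodic solutions with winding number $N$) correspond to fixed points of $P_N$. A fixed point $z$ of a one-to-one continuous map $S:U\subset\mathbb{R}^2\to\mathbb{R}^2$ is stable (in the sense of Liapunov) if for every neighbourhood $V$ of $z$ there is a neighbourhood $W\subset V$ of $z$ such that for each $n>0$, $S^n(W)$ is well defined and $S^n(W)\subset V$; otherwise it is unstable. A $T$-periodic solution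 with winding number $N$ is called unstable if the corresponding fixed point of $P_N$ is unstable. *)

theory Defs
  imports "HOL-Analysis.Analysis"
begin

definition momentum :: "(real \<Rightarrow> real) \<Rightarrow> real \<Rightarrow> real" where
  "momentum x t = deriv x t / sqrt (1 - (deriv x t)\<^sup>2)"

definition is_solution :: "real \<Rightarrow> (real \<Rightarrow> real) \<Rightarrow> (real \<Rightarrow> real) \<Rightarrow> bool" where
  "is_solution a f x \<longleftrightarrow>
     x C1_differentiable_on UNIV \<and>
     (\<forall>t. \<bar>deriv x t\<bar> < 1) \<and>
     momentum x C1_differentiable_on UNIV \<and>
     (\<forall>t. deriv (momentum x) t + a * sin (x t) = f t)"

definition winding_periodic :: "real \<Rightarrow> int \<Rightarrow> (real \<Rightarrow> real) \<Rightarrow> bool" where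
  "winding_periodic T N x \<longleftrightarrow> (\<forall>t. x (t + T) = x t + 2 * of_int N * pi)"

definition system_solution ::
    "real \<Rightarrow> (real \<Rightarrow> real) \<Rightarrow> (real \<Rightarrow> real \<times> real) \<Rightarrow> bool" where
  "system_solution a f u \<longleftrightarrow>
     (\<forall>t. (u has_vector_derivative
            (snd (u t) / sqrt (1 + (snd (u t))\<^sup>2), - a * sin (fst (u t)) + f t)) (at t))"

text \<open>For continuous \<open>f\<close> the right-hand side of the system is continuous and globally Lipschitz in
  \<open>(q, p)\<close>, so every initial value problem has exactly one global solution and the definite
  description below is proper.\<close>

definition trajectory :: "real \<Rightarrow> (real \<Rightarrow> real) \<Rightarrow> real \<times> real \<Rightarrow> real \<Rightarrow> real \<times> real" where
  "trajectory a f z = (THE u. system_solution a f u \<and> u 0 = z)"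

definition poincare_map ::
    "real \<Rightarrow> (real \<Rightarrow> real) \<Rightarrow> real \<Rightarrow> int \<Rightarrow> real \<times> real \<Rightarrow> real \<times> real" where
  "poincare_map a f T N z =
     (fst (trajectory a f z T) - 2 * of_int N * pi, snd (trajectory a f z T))"

text \<open>\<open>U\<close> is the domain of the map \<open>S\<close>. The iterate \<open>S ^^ n\<close> is well defined on \<open>W\<close> iff
  all earlier iterates map \<open>W\<close> into \<open>U\<close>. A neighbourhood of \<open>z\<close> is a set with \<open>z\<close> in its
  interior.\<close>

definition liapunov_stable ::
    "(real \<times> real) set \<Rightarrow> (real \<times> real \<Rightarrow> real \<times> real) \<Rightarrow> real \<times> real \<Rightarrow> bool" where
  "liapunov_stable U S z \<longleftrightarrow>
     (\<forall>V. z \<in> interior V \<longrightarrow>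
       (\<exists>W. z \<in> interior W \<and> W \<subseteq> V \<and>
         (\<forall>n>0. (\<forall>k<n. (S ^^ k) ` W \<subseteq> U) \<and> (S ^^ n) ` W \<subseteq> V)))"

definition unstable_fixed_point ::
    "(real \<times> real) set \<Rightarrow> (real \<times> real \<Rightarrow> real \<times> real) \<Rightarrow> real \<times> real \<Rightarrow> bool" where
  "unstable_fixed_point U S z \<longleftrightarrow> z \<in> U \<and> S z = z \<and> \<not> liapunov_stable U S z"

text \<open>The Poincare map is defined on the whole plane, since solutions of the system are global.\<close>

definition unstable_solution ::
    "real \<Rightarrow> (real \<Rightarrow> real) \<Rightarrow> real \<Rightarrow> int \<Rightarrow> (real \<Rightarrow> real) \<Rightarrow> bool" where
  "unstable_solution a f T N x \<longleftrightarrow>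
     unstable_fixed_point UNIV (poincare_map a f T N) (x 0, momentum x 0)"

end

theory Submission
  imports Defs
begin

text \<open>
  The proof is variational and exploits the order of the real line.

  Time is cut into short steps of length \<open>\<tau>\<close>. On one step the positions at both ends determine a
  solution (\<open>join_exists\<close>, \<open>join_unique\<close>), so a sequence of positions at the nodes is a broken
  solution. Its jumps of momentum \<open>G\<close> are the gradient of the action \<open>W\<close> (\<open>h_expansion\<close>), and the
  critical sequences are the solutions. The system is a twist: the initial momentum on a step
  increases with the final position and the final momentum decreases with the initial position
  (\<open>Y_mono\<close>, \<open>Z_antimono\<close>). Hence gradient descent with a small step size not only lowers the action
  (\<open>action_descends\<close>) but preserves the pointwise order of sequences (\<open>descend_mono\<close>), and it commutes
  with the shift by one period and with translations by \<open>2 \<pi>\<close>.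

  An unstable solution comes from solutions that gain one extra turn in \<open>n\<close> periods, that is,
  \<open>n N + 1\<close> turns over time \<open>n T\<close>. Descent from an equidistant sequence yields such a solution
  that moves monotonically with respect to the winding number \<open>N\<close> (\<open>ordered_critical_exists\<close>). During
  one of the \<open>n\<close> periods it advances by at most \<open>2 \<pi> / n\<close>, and because of the order its momentum then
  changes by at most a constant times \<open>1 / n\<close> (\<open>ordered_momentum_gap\<close>). Its phase point at the
  beginning of that period is thus almost fixed by the map \<open>P_N\<close>, but after \<open>n\<close> iterations it has moved
  by \<open>2 \<pi>\<close>. As \<open>n\<close> grows these points accumulate at a fixed point, which is unstable because orbits
  starting arbitrarily close to it leave (\<open>unstable_if_drifting_orbits_accumulate\<close>).

  The second solution is a mountain pass between the critical sequence \<open>q\<close> of the first one and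
  \<open>q + 2 \<pi>\<close>, obtained from the monotone descent and the connectedness of a segment
  (\<open>second_critical_exists\<close>).

  The relativistic velocity is bounded and its slope tends to \<open>0\<close>, which would restrict the boundary
  value problems to nearby positions. The velocity is therefore replaced by a function with slope
  \<open>1\<close> beyond a momentum \<open>M\<close>. All solutions used advance, over some fixed number of periods, by less
  than a speed smaller than \<open>1\<close> allows; this keeps their momentum below a bound that depends
  neither on \<open>n\<close> nor on the cut-off (\<open>momentum_bounded_if_slow\<close>), and \<open>M\<close> is chosen to be that bound.
\<close>

section \<open>Global solutions of Lipschitz differential equations\<close>

lemma antiderivative_exists:
  fixes \<phi> :: "real \<Rightarrow> 'a::euclidean_space"
  assumes "continuous_on UNIV \<phi>"
  shows "\<exists>F. \<forall>t. (F has_vector_derivative \<phi> t) (at t)"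
proof -
  have "\<exists>F. \<forall>t::real. (-\<infinity>::ereal) < t \<longrightarrow> t < \<infinity> \<longrightarrow> (F has_vector_derivative \<phi> t) (at t)"
    by (rule einterval_antiderivative) (use assms in \<open>auto simp: continuous_on_eq_continuous_at\<close>)
  then show ?thesis by auto
qed

text \<open>The estimate behind the weighted norm of the next lemma: integration gains the factor \<open>1 / K\<close>.\<close>

lemma exponential_increment_bound:
  fixes F :: "real \<Rightarrow> 'a::euclidean_space"
  assumes F: "\<And>t. (F has_vector_derivative \<phi> t) (at t)"
    and bnd: "\<And>t. norm (\<phi> t) \<le> A * exp (K * \<bar>t - s\<bar>)"
    and "K > 0" and "A \<ge> 0"
  shows "norm (F t - F s) \<le> A / K * exp (K * \<bar>t - s\<bar>)"
proof -
  have contF: "continuous_on S F" for S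
    using F has_vector_derivative_continuous continuous_at_imp_continuous_on by blast
  consider "s < t" | "t < s" | "s = t" by linarith
  then show ?thesis
  proof cases
    case 1
    let ?g = "\<lambda>r. A / K * exp (K * (r - s))"
    have g: "(?g has_vector_derivative A * exp (K * (r - s))) (at r)" for r
      unfolding has_real_derivative_iff_has_vector_derivative[symmetric]
      using \<open>K > 0\<close> by (auto intro!: derivative_eq_intros)
    have "norm (F t - F s) \<le> ?g t - ?g s"
    proof (rule differentiable_bound_general[OF 1 contF _ F g])
      show "continuous_on {s..t} ?g" by (intro continuous_intros)
      show "norm (\<phi> r) \<le> A * exp (K * (r - s))" if "s < r" "r < t" for r
        using bnd[of r] that by simp
    qed
    also have "\<dots> \<le> ?g t" using \<open>A \<ge> 0\<close> \<open>K > 0\<close> by simp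
    finally show ?thesis using 1 by simp
  next
    case 2
    let ?g = "\<lambda>r. - (A / K) * exp (K * (s - r))"
    have g: "(?g has_vector_derivative A * exp (K * (s - r))) (at r)" for r
      unfolding has_real_derivative_iff_has_vector_derivative[symmetric]
      using \<open>K > 0\<close> by (auto intro!: derivative_eq_intros)
    have "norm (F s - F t) \<le> ?g s - ?g t"
    proof (rule differentiable_bound_general[OF 2 contF _ F g])
      show "continuous_on {t..s} ?g" by (intro continuous_intros)
      show "norm (\<phi> r) \<le> A * exp (K * (s - r))" if "t < r" "r < s" for r
        using bnd[of r] that by (simp add: abs_minus_commute)
    qed
    also have "\<dots> \<le> - ?g t" using \<open>A \<ge> 0\<close> \<open>K > 0\<close> by simp
    finally show ?thesis using 2 by (simp add: norm_minus_commute abs_minus_commute)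
  next
    case 3
    then show ?thesis using assms by simp
  qed
qed

text \<open>In the norm \<open>sup \<parallel>u t\<parallel> exp (- 2 L \<bar>t - s\<bar>)\<close> the Picard operator is a contraction with factor
  \<open>1/2\<close> on the whole time axis, so a single application of Banach's theorem gives a solution that is
  global. The operator acts on the rescaled functions \<open>w t = exp (- 2 L \<bar>t - s\<bar>) u t\<close>, which are
  bounded.\<close>

lemma global_ode_solution:
  fixes X :: "real \<Rightarrow> 'a::euclidean_space \<Rightarrow> 'a"
  assumes cont: "\<And>u. continuous_on UNIV u \<Longrightarrow> continuous_on UNIV (\<lambda>t. X t (u t))"
    and lip: "\<And>t x y. norm (X t x - X t y) \<le> L * norm (x - y)"
    and bound: "\<And>t. norm (X t 0) \<le> B"
    and "L > 0"
  shows "\<exists>u. u s = z \<and> (\<forall>t. (u has_vector_derivative X t (u t)) (at t))"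
proof -
  define K where "K = 2 * L"
  have "K > 0" using \<open>L > 0\<close> by (simp add: K_def)
  have B0: "B \<ge> 0" using bound[of 0] norm_ge_zero order_trans by blast
  define E where "E t = exp (K * \<bar>t - s\<bar>)" for t
  have E1: "E t \<ge> 1" for t unfolding E_def using \<open>K > 0\<close> by simp
  have contE: "continuous_on UNIV E" unfolding E_def by (intro continuous_intros)
  define P where "P \<phi> = (SOME F. \<forall>t. (F has_vector_derivative \<phi> t) (at t))"
    for \<phi> :: "real \<Rightarrow> 'a"
  have P: "(P \<phi> has_vector_derivative \<phi> t) (at t)" if "continuous_on UNIV \<phi>" for \<phi> t
    unfolding P_def using someI_ex[OF antiderivative_exists[OF that]] by blast
  define rhs where "rhs w t = X t (E t *\<^sub>R w t)" for w t
  have crhs: "continuous_on UNIV (rhs w)" if "continuous_on UNIV w" for w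
    unfolding rhs_def by (intro cont continuous_intros contE that)
  define Op where "Op w t = (1 / E t) *\<^sub>R (z + (P (rhs w) t - P (rhs w) s))" for w t
  have contOp: "continuous_on UNIV (Op w)" if "continuous_on UNIV w" for w
  proof -
    have "continuous_on UNIV (P (rhs w))"
      using P[OF crhs[OF that]] has_vector_derivative_continuous continuous_at_imp_continuous_on
      by blast
    then show ?thesis unfolding Op_def
      using E1 by (intro continuous_intros contE) (smt (verit))+
  qed
  have bcOp: "Op w \<in> bcontfun" if w: "w \<in> bcontfun" for w
  proof -
    have cw: "continuous_on UNIV w" and "bounded (range w)" using w by (auto simp: bcontfun_def)
    then obtain b where b: "\<And>t. norm (w t) \<le> b" by (auto simp: bounded_iff)
    have b0: "b \<ge> 0" using b[of 0] norm_ge_zero order_trans by blast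
    have "norm (rhs w t) \<le> (B + L * b) * exp (K * \<bar>t - s\<bar>)" for t
    proof -
      have "norm (rhs w t) \<le> norm (X t 0) + norm (X t (E t *\<^sub>R w t) - X t 0)"
        unfolding rhs_def by (metis add.commute diff_add_cancel norm_triangle_ineq)
      also have "\<dots> \<le> B + L * norm (E t *\<^sub>R w t)"
        using bound[of t] lip[of t "E t *\<^sub>R w t" 0] by simp
      also have "norm (E t *\<^sub>R w t) \<le> E t * b" using E1[of t] b[of t]
        by (simp add: mult_left_mono)
      also have "B \<le> B * E t" using B0 E1[of t] by (simp add: mult_le_cancel_left1)
      finally show ?thesis using \<open>L > 0\<close> by (simp add: algebra_simps E_def)
    qed
    then have inc: "norm (P (rhs w) t - P (rhs w) s) \<le> (B + L * b) / K * E t" for t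
      unfolding E_def
      using exponential_increment_bound[OF P[OF crhs[OF cw]] _ \<open>K > 0\<close>] B0 b0 \<open>L > 0\<close> by simp
    have "norm (Op w t) \<le> norm z + (B + L * b) / K" for t
    proof -
      have "norm (Op w t) = norm (z + (P (rhs w) t - P (rhs w) s)) / E t"
        unfolding Op_def using E1[of t] by simp
      also have "\<dots> \<le> (norm z + (B + L * b) / K * E t) / E t"
        using E1[of t] inc[of t] norm_triangle_le[of z "P (rhs w) t - P (rhs w) s"]
        by (intro divide_right_mono norm_triangle_le) auto
      also have "\<dots> = norm z / E t + (B + L * b) / K" using E1[of t] by (simp add: field_simps)
      also have "norm z / E t \<le> norm z" using E1[of t] by (simp add: divide_le_eq mult_le_cancel_left1)
      finally show ?thesis by simp
    qed
    then have "bounded (range (Op w))" unfolding bounded_iff by blast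
    then show ?thesis using contOp[OF cw] by (simp add: bcontfun_def)
  qed
  have contr: "norm (Op v t - Op w t) \<le> 1 / 2 * d"
    if v: "continuous_on UNIV v" and w: "continuous_on UNIV w"
      and d: "\<And>t. norm (v t - w t) \<le> d" for v w d t
  proof -
    have d0: "d \<ge> 0" using d[of 0] norm_ge_zero order_trans by blast
    let ?F = "\<lambda>t. P (rhs v) t - P (rhs w) t"
    have F: "(?F has_vector_derivative (rhs v t - rhs w t)) (at t)" for t
      by (intro has_vector_derivative_diff P crhs v w)
    have "norm (rhs v t - rhs w t) \<le> (L * d) * exp (K * \<bar>t - s\<bar>)" for t
    proof -
      have "norm (rhs v t - rhs w t) \<le> L * norm (E t *\<^sub>R v t - E t *\<^sub>R w t)"
        unfolding rhs_def by (rule lip)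
      also have "norm (E t *\<^sub>R v t - E t *\<^sub>R w t) = E t * norm (v t - w t)"
        using E1[of t] by (simp flip: scaleR_diff_right)
      also have "\<dots> \<le> E t * d" using E1[of t] d[of t] by (simp add: mult_left_mono)
      finally show ?thesis using \<open>L > 0\<close> by (simp add: E_def algebra_simps)
    qed
    from exponential_increment_bound[OF F this \<open>K > 0\<close>]
    have "norm (?F t - ?F s) \<le> (L * d) / K * E t"
      using d0 \<open>L > 0\<close> by (simp add: E_def)
    then have "norm (?F t - ?F s) / E t \<le> ((L * d) / K * E t) / E t"
      using E1[of t] by (intro divide_right_mono) auto
    moreover have "Op v t - Op w t = (1 / E t) *\<^sub>R (?F t - ?F s)"
      unfolding Op_def by (simp add: algebra_simps)
    ultimately have "norm (Op v t - Op w t) \<le> ((L * d) / K * E t) / E t"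
      using E1[of t] by simp
    also have "\<dots> = 1 / 2 * d" using E1[of t] \<open>L > 0\<close> by (simp add: K_def)
    finally show ?thesis .
  qed
  define \<Phi> where "\<Phi> w = Bcontfun (Op (apply_bcontfun w))" for w :: "real \<Rightarrow>\<^sub>C 'a"
  have \<Phi>: "apply_bcontfun (\<Phi> w) = Op (apply_bcontfun w)" for w
    unfolding \<Phi>_def by (rule Bcontfun_inverse) (rule bcOp[OF apply_bcontfun])
  have "\<exists>!w. \<Phi> w = w"
  proof (rule banach_fix_type)
    show "\<forall>v w. dist (\<Phi> v) (\<Phi> w) \<le> 1 / 2 * dist v w"
    proof (intro allI dist_bound)
      fix v w :: "real \<Rightarrow>\<^sub>C 'a" and t
      show "dist (\<Phi> v t) (\<Phi> w t) \<le> 1 / 2 * dist v w"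
        unfolding \<Phi> dist_norm
        by (rule contr) (use dist_bounded[of v _ w] in \<open>auto simp: dist_norm\<close>)
    qed
  qed auto
  then obtain W where W: "\<Phi> W = W" by blast
  define w where "w = apply_bcontfun W"
  have w: "Op w = w" using \<Phi>[of W] W by (simp add: w_def)
  have cw: "continuous_on UNIV w" by (simp add: w_def)
  define u where "u t = E t *\<^sub>R w t" for t
  have u: "u t = z + (P (rhs w) t - P (rhs w) s)" for t
  proof -
    have "u t = E t *\<^sub>R Op w t" unfolding u_def w ..
    then show ?thesis unfolding Op_def using E1[of t] by (simp add: less_le_trans[OF zero_less_one])
  qed
  have "(u has_vector_derivative X t (u t)) (at t)" for t
  proof -
    have "((\<lambda>t. z + (P (rhs w) t - P (rhs w) s)) has_vector_derivative (0 + (rhs w t - 0))) (at t)"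
      by (intro has_vector_derivative_add has_vector_derivative_diff has_vector_derivative_const
          P crhs cw)
    moreover have "(\<lambda>t. z + (P (rhs w) t - P (rhs w) s)) = u" using u by (simp add: fun_eq_iff)
    moreover have "rhs w t = X t (u t)" by (simp add: rhs_def u_def)
    ultimately show ?thesis by simp
  qed
  moreover have "u s = z" by (simp add: u)
  ultimately show ?thesis by blast
qed

text \<open>Gronwall in both time directions: \<open>\<parallel>u - v\<parallel>\<^sup>2 exp (- 2 L t)\<close> decreases and
  \<open>\<parallel>u - v\<parallel>\<^sup>2 exp (2 L t)\<close> increases.\<close>

lemma ode_gronwall:
  fixes X :: "real \<Rightarrow> 'a::euclidean_space \<Rightarrow> 'a"
  assumes lip: "\<And>t x y. norm (X t x - X t y) \<le> L * norm (x - y)"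
    and u: "\<And>t. (u has_vector_derivative X t (u t)) (at t)"
    and v: "\<And>t. (v has_vector_derivative X t (v t)) (at t)"
  shows "norm (u t - v t) \<le> exp (L * \<bar>t - s\<bar>) * norm (u s - v s)"
proof -
  define D where "D t = u t - v t" for t
  define D' where "D' t = X t (u t) - X t (v t)" for t
  define n where "n t = D t \<bullet> D t" for t
  have D: "(D has_vector_derivative D' t) (at t)" for t
    unfolding D_def D'_def by (intro has_vector_derivative_diff u v)
  have n: "(n has_real_derivative 2 * (D t \<bullet> D' t)) (at t)" for t
  proof -
    have "(n has_derivative (\<lambda>h. D t \<bullet> (h *\<^sub>R D' t) + (h *\<^sub>R D' t) \<bullet> D t)) (at t)"
      unfolding n_def using D[of t, unfolded has_vector_derivative_def]
      by (intro has_derivative_inner)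
    then show ?thesis unfolding has_field_derivative_def
      by (rule has_derivative_eq_rhs) (auto simp: inner_commute fun_eq_iff)
  qed
  have nb: "\<bar>2 * (D t \<bullet> D' t)\<bar> \<le> 2 * L * n t" for t
  proof -
    have "\<bar>D t \<bullet> D' t\<bar> \<le> norm (D t) * norm (D' t)" by (rule Cauchy_Schwarz_ineq2)
    also have "\<dots> \<le> norm (D t) * (L * norm (D t))"
      unfolding D_def D'_def by (intro mult_left_mono lip) auto
    also have "\<dots> = L * n t" by (simp add: n_def dot_square_norm power2_eq_square)
    finally show ?thesis by simp
  qed
  have down: "n t2 * exp (- 2 * L * t2) \<le> n t1 * exp (- 2 * L * t1)" if "t1 \<le> t2" for t1 t2
  proof (rule DERIV_nonpos_imp_nonincreasing[OF that])
    fix t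
    have "((\<lambda>t. n t * exp (- 2 * L * t)) has_real_derivative
       (2 * (D t \<bullet> D' t) - 2 * L * n t) * exp (- 2 * L * t)) (at t)"
      by (auto intro!: derivative_eq_intros n simp: algebra_simps)
    moreover have "(2 * (D t \<bullet> D' t) - 2 * L * n t) * exp (- 2 * L * t) \<le> 0"
      using nb[of t] by (intro mult_nonpos_nonneg) auto
    ultimately show "\<exists>y. ((\<lambda>t. n t * exp (- 2 * L * t)) has_real_derivative y) (at t) \<and> y \<le> 0"
      by blast
  qed
  have up: "n t1 * exp (2 * L * t1) \<le> n t2 * exp (2 * L * t2)" if "t1 \<le> t2" for t1 t2
  proof (rule DERIV_nonneg_imp_nondecreasing[OF that])
    fix t
    have "((\<lambda>t. n t * exp (2 * L * t)) has_real_derivative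
       (2 * (D t \<bullet> D' t) + 2 * L * n t) * exp (2 * L * t)) (at t)"
      by (auto intro!: derivative_eq_intros n simp: algebra_simps)
    moreover have "(2 * (D t \<bullet> D' t) + 2 * L * n t) * exp (2 * L * t) \<ge> 0"
      using nb[of t] by (intro mult_nonneg_nonneg) auto
    ultimately show "\<exists>y. ((\<lambda>t. n t * exp (2 * L * t)) has_real_derivative y) (at t) \<and> y \<ge> 0"
      by blast
  qed
  have sq: "n t \<le> exp (2 * L * \<bar>t - s\<bar>) * n s"
  proof (cases "s \<le> t")
    case True
    have "n t = (n t * exp (- 2 * L * t)) * exp (2 * L * t)" by (simp flip: exp_add)
    also have "\<dots> \<le> (n s * exp (- 2 * L * s)) * exp (2 * L * t)"
      using down[OF True] by (intro mult_right_mono) auto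
    also have "\<dots> = exp (2 * L * \<bar>t - s\<bar>) * n s"
      using True by (simp add: algebra_simps flip: exp_add)
    finally show ?thesis .
  next
    case False
    have "n t = (n t * exp (2 * L * t)) * exp (- 2 * L * t)" by (simp flip: exp_add)
    also have "\<dots> \<le> (n s * exp (2 * L * s)) * exp (- 2 * L * t)"
      using up[of t s] False by (intro mult_right_mono) auto
    also have "\<dots> = exp (2 * L * \<bar>t - s\<bar>) * n s"
      using False by (simp add: algebra_simps flip: exp_add)
    finally show ?thesis .
  qed
  show ?thesis
  proof (rule power2_le_imp_le)
    show "(norm (u t - v t))\<^sup>2 \<le> (exp (L * \<bar>t - s\<bar>) * norm (u s - v s))\<^sup>2"
      using sq unfolding n_def D_def
      by (simp add: power_mult_distrib flip: exp_double dot_square_norm mult.assoc)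
  qed simp
qed

section \<open>Pendulum-type systems\<close>

lemma sin_lipschitz: "\<bar>sin x - sin y\<bar> \<le> \<bar>x - y\<bar>" for x y :: real
  using field_differentiable_bound[of UNIV sin cos 1 x y]
  by (auto intro!: derivative_eq_intros)


text \<open>A common frame for the relativistic system, where \<open>g p = p / sqrt (1 + p\<^sup>2)\<close>, and for the
  system in which the velocity \<open>g\<close> has been changed for large momenta.\<close>

locale forced_system =
  fixes a :: real and f g :: "real \<Rightarrow> real" and Bf :: real
  assumes a_pos: "a > 0"
    and f_cont: "continuous_on UNIV f"
    and f_bound: "\<And>t. \<bar>f t\<bar> \<le> Bf"
    and g_lip: "\<And>p P. \<bar>g P - g p\<bar> \<le> \<bar>P - p\<bar>"
    and g_0 [simp]: "g 0 = 0"
begin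

definition field :: "real \<Rightarrow> real \<times> real \<Rightarrow> real \<times> real" where
  "field t z = (g (snd z), - a * sin (fst z) + f t)"

definition is_sol :: "(real \<Rightarrow> real \<times> real) \<Rightarrow> bool" where
  "is_sol u \<longleftrightarrow> (\<forall>t. (u has_vector_derivative field t (u t)) (at t))"

lemma field_lipschitz: "norm (field t x - field t y) \<le> (1 + a) * norm (x - y)"
proof -
  have "norm (field t x - field t y)
      = norm (g (snd x) - g (snd y), - a * sin (fst x) - (- a * sin (fst y)))"
    by (simp add: field_def)
  also have "\<dots> \<le> \<bar>g (snd x) - g (snd y)\<bar> + \<bar>- a * sin (fst x) - (- a * sin (fst y))\<bar>"
    by (metis norm_Pair_le real_norm_def)
  also have "\<bar>- a * sin (fst x) - (- a * sin (fst y))\<bar> = a * \<bar>sin (fst x) - sin (fst y)\<bar>"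
    using a_pos by (simp add: abs_mult flip: right_diff_distrib abs_minus_commute)
  also have "\<dots> \<le> a * \<bar>fst x - fst y\<bar>"
    using a_pos sin_lipschitz by (simp add: mult_left_mono)
  also have "\<bar>g (snd x) - g (snd y)\<bar> \<le> norm (x - y)"
    using g_lip[of "snd x" "snd y"] norm_snd_le[of "snd x - snd y" "fst x - fst y"]
    by (simp add: minus_prod_def)
  also have "\<bar>fst x - fst y\<bar> \<le> norm (x - y)"
    using norm_fst_le[of "fst x - fst y" "snd x - snd y"]
    by (simp add: minus_prod_def)
  finally show ?thesis using a_pos by (simp add: algebra_simps)
qed

lemma g_continuous: "continuous_on S g"
  by (rule continuous_on_subset[OF lipschitz_on_continuous_on[of 1 UNIV]])
    (auto simp: lipschitz_on_def dist_real_def g_lip)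

lemma sol_exists: "\<exists>u. u s = z \<and> is_sol u"
  unfolding is_sol_def
proof (rule global_ode_solution)
  show "continuous_on UNIV (\<lambda>t. field t (u t))" if "continuous_on UNIV u" for u
    unfolding field_def
    by (intro continuous_intros continuous_on_compose2[OF g_continuous] f_cont that) auto
  show "norm (field t 0) \<le> Bf" for t
    using f_bound[of t] by (simp add: field_def norm_Pair)
  show "norm (field t x - field t y) \<le> (1 + a) * norm (x - y)" for t x y
    by (rule field_lipschitz)
qed (use a_pos in simp)

lemma sol_gronwall:
  assumes "is_sol u" "is_sol v"
  shows "norm (u t - v t) \<le> exp ((1 + a) * \<bar>t - s\<bar>) * norm (u s - v s)"
  by (rule ode_gronwall[of field, OF field_lipschitz]) (use assms in \<open>auto simp: is_sol_def\<close>)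

lemma sol_unique:
  assumes "is_sol u" "is_sol v" "u s = v s"
  shows "u = v"
  using sol_gronwall[OF assms(1,2), of _ s] assms(3) by (auto simp: fun_eq_iff)

text \<open>The symmetries of the system: the period of the forcing and the period of the sine.\<close>

lemma sol_shift:
  assumes u: "is_sol u" and per: "\<And>t. f (t + d) = f t"
  shows "is_sol (\<lambda>t. u (t + d) + (2 * pi * of_int k, 0))"
  unfolding is_sol_def
proof
  fix t
  have "((\<lambda>t. u (t + d)) has_vector_derivative field (t + d) (u (t + d))) (at t)"
  proof -
    have "((\<lambda>t. t + d) has_vector_derivative 1) (at t)"
      by (auto intro!: derivative_eq_intros)
    from vector_diff_chain_at[OF this u[unfolded is_sol_def, rule_format]]
    show ?thesis by (simp add: o_def)
  qed
  moreover have "sin (x + 2 * pi * of_int k) = sin x" for x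
    using sin_add[of x "2 * pi * of_int k"]
    by (metis add.right_neutral cos_int_2pin mult.commute mult.right_neutral mult_zero_right sin_int_2pin)
  ultimately show "((\<lambda>t. u (t + d) + (2 * pi * of_int k, 0)) has_vector_derivative
      field t (u (t + d) + (2 * pi * of_int k, 0))) (at t)"
    by (auto simp: field_def per intro!: derivative_eq_intros)
qed

lemma sol_components:
  assumes "is_sol u"
  shows "((\<lambda>t. fst (u t)) has_real_derivative g (snd (u t))) (at t)"
    and "((\<lambda>t. snd (u t)) has_real_derivative (- a * sin (fst (u t)) + f t)) (at t)"
proof -
  have *: "(u has_vector_derivative field t (u t)) (at t)" using assms by (simp add: is_sol_def)
  show "((\<lambda>t. fst (u t)) has_real_derivative g (snd (u t))) (at t)"
    using has_derivative_fst[OF *[unfolded has_vector_derivative_def]]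
    by (simp add: field_def has_field_derivative_def mult_commute_abs)
  show "((\<lambda>t. snd (u t)) has_real_derivative (- a * sin (fst (u t)) + f t)) (at t)"
    using has_derivative_snd[OF *[unfolded has_vector_derivative_def]]
    by (simp add: field_def has_field_derivative_def mult_commute_abs)
qed

end

section \<open>The two-point boundary value problem over a short time step\<close>

text \<open>The lower bound \<open>c\<close> for the slope of the velocity is what makes short boundary value problems
  solvable for all pairs of positions. The function \<open>F\<close> is a periodic antiderivative of the forcing,
  which exists because the forcing has mean zero, and \<open>\<Gamma>\<close> is the kinetic part of the Hamiltonian.\<close>

locale twist_system = forced_system +
  fixes F \<Gamma> :: "real \<Rightarrow> real" and c T BF :: real and \<nu> :: nat
  assumes c_pos: "c > 0"
    and g_mono: "\<And>p P. p \<le> P \<Longrightarrow> c * (P - p) \<le> g P - g p"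
    and F_deriv: "\<And>t. (F has_real_derivative f t) (at t)"
    and F_per: "\<And>t. F (t + T) = F t"
    and F_bound: "\<And>t. \<bar>F t\<bar> \<le> BF"
    and \<Gamma>_deriv: "\<And>p. (\<Gamma> has_real_derivative g p) (at p)"
    and T_pos: "T > 0"
    and f_per: "\<And>t. f (t + T) = f t"
    and \<nu>_pos: "\<nu> > 0"
    and short_step: "a * (T / real \<nu>)\<^sup>2 \<le> 1 / 4"
begin

definition \<tau> :: real where "\<tau> = T / real \<nu>"

definition node :: "int \<Rightarrow> real" where "node i = of_int i * \<tau>"

lemma \<tau>_pos: "\<tau> > 0"
  using T_pos \<nu>_pos by (simp add: \<tau>_def)

lemma node_Suc: "node (i + 1) = node i + \<tau>"
  by (simp add: node_def algebra_simps)

lemma node_shift: "node (i + int (n * \<nu>)) = node i + of_nat n * T"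
  using \<nu>_pos by (simp add: node_def \<tau>_def field_simps)

definition dq :: "(real \<Rightarrow> real \<times> real) \<Rightarrow> (real \<Rightarrow> real \<times> real) \<Rightarrow> real \<Rightarrow> real" where
  "dq u v t = fst (v t) - fst (u t)"

definition dp :: "(real \<Rightarrow> real \<times> real) \<Rightarrow> (real \<Rightarrow> real \<times> real) \<Rightarrow> real \<Rightarrow> real" where
  "dp u v t = snd (v t) - snd (u t)"

lemma dq_deriv:
  assumes "is_sol u" "is_sol v"
  shows "(dq u v has_real_derivative g (snd (v t)) - g (snd (u t))) (at t)"
  unfolding dq_def[abs_def] using assms by (intro DERIV_diff sol_components)

lemma dp_deriv:
  assumes "is_sol u" "is_sol v"
  shows "(dp u v has_real_derivative - a * (sin (fst (v t)) - sin (fst (u t)))) (at t)"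
proof -
  have "(dp u v has_real_derivative
      (- a * sin (fst (v t)) + f t) - (- a * sin (fst (u t)) + f t)) (at t)"
    unfolding dp_def[abs_def] using assms by (intro DERIV_diff sol_components)
  then show ?thesis by (simp add: algebra_simps)
qed

lemma dq_swap: "dq v u t = - dq u v t" and dp_swap: "dp v u t = - dp u v t"
  by (simp_all add: dq_def dp_def)

text \<open>The maximal momentum gap \<open>D\<close>, attained at time \<open>m\<close>, controls the position gap, since the velocity is
  \<open>1\<close>-Lipschitz; the position gap in turn controls the variation of the momentum gap, since the force
  is \<open>a\<close>-Lipschitz. The condition \<open>a \<tau>\<^sup>2 \<le> 1/4\<close> makes the resulting feedback of \<open>D\<close> on itself at most
  \<open>D / 4\<close>.\<close>

lemma increments_on_step:
  assumes u: "is_sol u" and v: "is_sol v" and r: "r \<in> {s..s + \<tau>}"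
  obtains D m where "D \<ge> 0" "m \<in> {s..s + \<tau>}" "\<bar>dp u v m\<bar> = D"
    "\<And>t. t \<in> {s..s + \<tau>} \<Longrightarrow> \<bar>dp u v t\<bar> \<le> D"
    "\<And>t. t \<in> {s..s + \<tau>} \<Longrightarrow> \<bar>dq u v t\<bar> \<le> \<bar>dq u v r\<bar> + \<tau> * D"
    "\<And>t. t \<in> {s..s + \<tau>} \<Longrightarrow> \<bar>dp u v t - dp u v m\<bar> \<le> a * \<tau> * \<bar>dq u v r\<bar> + D / 4"
proof -
  let ?I = "{s..s + \<tau>}"
  have "continuous_on ?I (dp u v)"
    using dp_deriv[OF u v] DERIV_isCont continuous_at_imp_continuous_on by blast
  then have "continuous_on ?I (\<lambda>t. \<bar>dp u v t\<bar>)" by (intro continuous_intros)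
  then obtain m where m: "m \<in> ?I" and max: "\<And>t. t \<in> ?I \<Longrightarrow> \<bar>dp u v t\<bar> \<le> \<bar>dp u v m\<bar>"
    using continuous_attains_sup[of ?I "\<lambda>t. \<bar>dp u v t\<bar>"] \<tau>_pos by auto
  define D where "D = \<bar>dp u v m\<bar>"
  have q: "\<bar>dq u v t\<bar> \<le> \<bar>dq u v r\<bar> + \<tau> * D" if t: "t \<in> ?I" for t
  proof -
    have "norm (dq u v t - dq u v r) \<le> D * norm (t - r)"
    proof (rule field_differentiable_bound[of ?I])
      show "(dq u v has_real_derivative g (snd (v x)) - g (snd (u x))) (at x within ?I)" for x
        using dq_deriv[OF u v] by (rule has_field_derivative_at_within)
      show "norm (g (snd (v x)) - g (snd (u x))) \<le> D" if "x \<in> ?I" for x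
        using g_lip[of "snd (v x)" "snd (u x)"] max[OF that] by (simp add: D_def dp_def)
    qed (use r t in auto)
    also have "\<dots> \<le> D * \<tau>" using r t by (intro mult_left_mono) (auto simp: D_def)
    finally show ?thesis by (simp add: mult.commute)
  qed
  have p: "\<bar>dp u v t - dp u v m\<bar> \<le> a * \<tau> * \<bar>dq u v r\<bar> + D / 4" if t: "t \<in> ?I" for t
  proof -
    let ?B = "a * (\<bar>dq u v r\<bar> + \<tau> * D)"
    have B0: "?B \<ge> 0" using a_pos \<tau>_pos by (simp add: D_def)
    have "norm (dp u v t - dp u v m) \<le> ?B * norm (t - m)"
    proof (rule field_differentiable_bound[of ?I])
      show "(dp u v has_real_derivative - a * (sin (fst (v x)) - sin (fst (u x)))) (at x within ?I)"
        for x using dp_deriv[OF u v] by (rule has_field_derivative_at_within)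
      show "norm (- a * (sin (fst (v x)) - sin (fst (u x)))) \<le> ?B" if "x \<in> ?I" for x
      proof -
        have "\<bar>sin (fst (v x)) - sin (fst (u x))\<bar> \<le> \<bar>dq u v r\<bar> + \<tau> * D"
          using sin_lipschitz[of "fst (v x)" "fst (u x)"] q[OF that] by (simp add: dq_def)
        then show ?thesis using a_pos by (simp add: abs_mult mult_left_mono)
      qed
    qed (use m t in auto)
    also have "\<dots> \<le> ?B * \<tau>" using m t B0 by (intro mult_left_mono) auto
    also have "\<dots> = a * \<tau> * \<bar>dq u v r\<bar> + (a * \<tau>\<^sup>2) * D"
      by (simp add: algebra_simps power2_eq_square)
    also have "(a * \<tau>\<^sup>2) * D \<le> (1 / 4) * D"
      using short_step by (intro mult_right_mono) (auto simp: \<tau>_def D_def)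
    finally show ?thesis by simp
  qed
  show ?thesis by (rule that[of D m]) (use m max q p in \<open>auto simp: D_def\<close>)
qed

lemma position_gap_increases:
  assumes u: "is_sol u" and v: "is_sol v"
    and low: "\<And>t. t \<in> {s..s + \<tau>} \<Longrightarrow> \<kappa> \<le> dp u v t" and "\<kappa> \<ge> 0"
  shows "c * \<kappa> * \<tau> \<le> dq u v (s + \<tau>) - dq u v s"
proof -
  have "dq u v s - c * \<kappa> * s \<le> dq u v (s + \<tau>) - c * \<kappa> * (s + \<tau>)"
  proof (rule DERIV_nonneg_imp_nondecreasing[of s "s + \<tau>" "\<lambda>t. dq u v t - c * \<kappa> * t"])
    fix t assume t: "s \<le> t" "t \<le> s + \<tau>"
    have "((\<lambda>t. dq u v t - c * \<kappa> * t) has_real_derivative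
        (g (snd (v t)) - g (snd (u t))) - c * \<kappa>) (at t)"
      by (auto intro!: derivative_eq_intros dq_deriv u v)
    moreover have "c * \<kappa> \<le> c * dp u v t" using low[of t] t c_pos by simp
    then have "(g (snd (v t)) - g (snd (u t))) - c * \<kappa> \<ge> 0"
      using g_mono[of "snd (u t)" "snd (v t)"] low[of t] t \<open>\<kappa> \<ge> 0\<close> by (simp add: dp_def)
    ultimately show "\<exists>y. ((\<lambda>t. dq u v t - c * \<kappa> * t) has_real_derivative y) (at t) \<and> 0 \<le> y"
      by blast
  qed (use \<tau>_pos in simp)
  then show ?thesis by (simp add: algebra_simps)
qed

text \<open>Over a short step the momenta of two solutions that share a position at time \<open>r\<close> differ by
  almost a constant, so the larger momentum at time \<open>r\<close> wins on the whole step.\<close>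

lemma twist:
  assumes u: "is_sol u" and v: "is_sol v" and r: "r \<in> {s..s + \<tau>}"
    and "dq u v r = 0" and pos: "dp u v r > 0"
  shows "3 / 4 * c * \<tau> * dp u v r \<le> dq u v (s + \<tau>) - dq u v s"
proof -
  obtain D m where D: "D \<ge> 0" "m \<in> {s..s + \<tau>}" "\<bar>dp u v m\<bar> = D"
    "\<And>t. t \<in> {s..s + \<tau>} \<Longrightarrow> \<bar>dp u v t\<bar> \<le> D"
    "\<And>t. t \<in> {s..s + \<tau>} \<Longrightarrow> \<bar>dp u v t - dp u v m\<bar> \<le> a * \<tau> * \<bar>dq u v r\<bar> + D / 4"
    using increments_on_step[OF u v r] by metis
  have close: "\<bar>dp u v t - dp u v m\<bar> \<le> D / 4" if "t \<in> {s..s + \<tau>}" for t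
    using D(5)[OF that] \<open>dq u v r = 0\<close> by simp
  have "dp u v r \<le> D" using D(4)[OF r] by simp
  moreover have "dp u v m = D" using close[OF r] D(3) pos D(4)[OF r] by linarith
  ultimately have "3 / 4 * dp u v r \<le> dp u v t" if "t \<in> {s..s + \<tau>}" for t
    using close[OF that] by linarith
  from position_gap_increases[OF u v this] pos show ?thesis by (simp add: algebra_simps)
qed

definition K :: real where "K = 4 / (c * \<tau>) + 2 * a * \<tau>"

lemma K_pos: "K > 0"
  using a_pos c_pos \<tau>_pos by (simp add: K_def add_pos_pos)

text \<open>Either the initial position gap dominates \<open>D\<close>, or the momentum gap stays above \<open>D / 4\<close> with a
  constant sign and then drives the positions apart by at least \<open>c \<tau> D / 4\<close>.\<close>

lemma momentum_gap_bound:
  assumes u: "is_sol u" and v: "is_sol v" and t: "t \<in> {s..s + \<tau>}"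
  shows "\<bar>dp u v t\<bar> \<le> K * (\<bar>dq u v s\<bar> + \<bar>dq u v (s + \<tau>)\<bar>)"
proof -
  let ?E = "\<bar>dq u v s\<bar> + \<bar>dq u v (s + \<tau>)\<bar>"
  have s: "s \<in> {s..s + \<tau>}" using \<tau>_pos by simp
  obtain D m where D: "D \<ge> 0" "m \<in> {s..s + \<tau>}" "\<bar>dp u v m\<bar> = D"
    "\<And>t. t \<in> {s..s + \<tau>} \<Longrightarrow> \<bar>dp u v t\<bar> \<le> D"
    "\<And>t. t \<in> {s..s + \<tau>} \<Longrightarrow> \<bar>dp u v t - dp u v m\<bar> \<le> a * \<tau> * \<bar>dq u v s\<bar> + D / 4"
    using increments_on_step[OF u v s] by metis
  have K: "K * ?E = 4 / (c * \<tau>) * ?E + 2 * (a * \<tau>) * ?E" by (simp add: K_def algebra_simps)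
  have pos: "0 \<le> 4 / (c * \<tau>) * ?E" "0 \<le> 2 * (a * \<tau>) * ?E"
    using a_pos c_pos \<tau>_pos by simp_all
  have "D \<le> K * ?E"
  proof (cases "D \<le> 2 * (a * \<tau>) * \<bar>dq u v s\<bar>")
    case True
    have "2 * (a * \<tau>) * \<bar>dq u v s\<bar> \<le> 2 * (a * \<tau>) * ?E" using a_pos \<tau>_pos by (intro mult_left_mono) auto
    then show ?thesis using True K pos by linarith
  next
    case False
    have away: "D / 4 \<le> \<sigma> * dp u v t" if "\<sigma> * dp u v m = D" "\<bar>\<sigma>\<bar> = 1" "t \<in> {s..s + \<tau>}" for \<sigma> t
    proof -
      have "\<bar>\<sigma> * dp u v t - \<sigma> * dp u v m\<bar> = \<bar>dp u v t - dp u v m\<bar>"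
        using that(2) by (metis abs_mult mult_1 right_diff_distrib)
      then show ?thesis using D(5)[OF that(3)] False that(1) by linarith
    qed
    have "c * (D / 4) * \<tau> \<le> ?E"
    proof (cases "dp u v m \<ge> 0")
      case True
      then have *: "D / 4 \<le> dp u v t" if "t \<in> {s..s + \<tau>}" for t
        using away[of 1 t] that D(3) by simp
      from position_gap_increases[OF u v, of s "D / 4"] * D(1) show ?thesis by fastforce
    next
      case False
      then have *: "D / 4 \<le> dp v u t" if "t \<in> {s..s + \<tau>}" for t
        using away[of "-1" t] that D(3) by (simp add: dp_swap[of v u])
      from position_gap_increases[OF v u, of s "D / 4"] * D(1) show ?thesis by (fastforce simp add: dq_swap[of v u])
    qed
    then have "D \<le> 4 / (c * \<tau>) * ?E" using c_pos \<tau>_pos by (simp add: field_simps)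
    then show ?thesis using K pos by linarith
  qed
  then show ?thesis using D(4)[OF t] by linarith
qed

lemma position_gap_bound:
  assumes u: "is_sol u" and v: "is_sol v" and t: "t \<in> {s..s + \<tau>}"
  shows "\<bar>dq u v t\<bar> \<le> (1 + \<tau> * K) * (\<bar>dq u v s\<bar> + \<bar>dq u v (s + \<tau>)\<bar>)"
proof -
  let ?E = "\<bar>dq u v s\<bar> + \<bar>dq u v (s + \<tau>)\<bar>"
  have s: "s \<in> {s..s + \<tau>}" using \<tau>_pos by simp
  obtain D m where D: "m \<in> {s..s + \<tau>}" "\<bar>dp u v m\<bar> = D"
    "\<And>t. t \<in> {s..s + \<tau>} \<Longrightarrow> \<bar>dq u v t\<bar> \<le> \<bar>dq u v s\<bar> + \<tau> * D"
    using increments_on_step[OF u v s] by metis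
  have "D \<le> K * ?E" using momentum_gap_bound[OF u v D(1)] D(2) by simp
  then have "\<tau> * D \<le> \<tau> * (K * ?E)" using \<tau>_pos by simp
  then show ?thesis using D(3)[OF t] by (simp add: algebra_simps)
qed

text \<open>Shooting: by \<open>twist\<close> the final position grows at least linearly with the initial momentum.\<close>

lemma join_exists: "\<exists>u. is_sol u \<and> fst (u s) = q \<and> fst (u (s + \<tau>)) = q'"
proof -
  define S where "S p = (SOME u. u s = (q, p) \<and> is_sol u)" for p
  have S: "S p s = (q, p)" "is_sol (S p)" for p
    unfolding S_def using someI_ex[OF sol_exists[of s "(q, p)"]] by auto
  define e where "e p = fst (S p (s + \<tau>))" for p
  have s: "s \<in> {s..s + \<tau>}" using \<tau>_pos by simp
  have cont: "continuous_on A e" for A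
  proof (rule continuous_on_subset[OF lipschitz_on_continuous_on])
    show "(exp ((1 + a) * \<tau>))-lipschitz_on UNIV e"
    proof (rule lipschitz_onI)
      fix p p'
      have "\<bar>e p - e p'\<bar> \<le> norm (S p (s + \<tau>) - S p' (s + \<tau>))"
        unfolding e_def by (metis fst_diff norm_fst_le prod.collapse real_norm_def)
      also have "\<dots> \<le> exp ((1 + a) * \<bar>s + \<tau> - s\<bar>) * norm (S p s - S p' s)"
        by (rule sol_gronwall) (rule S)+
      finally show "dist (e p) (e p') \<le> exp ((1 + a) * \<tau>) * dist p p'"
        using \<tau>_pos by (simp add: S(1) dist_real_def norm_Pair)
    qed simp
  qed simp
  have slope: "3 / 4 * c * \<tau> * (p' - p) \<le> e p' - e p" if "p \<le> p'" for p p'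
    using twist[OF S(2)[of p] S(2)[of p'] s] S(1) that
    by (cases "p = p'") (auto simp: dq_def dp_def e_def)
  let ?w = "3 / 4 * c * \<tau>"
  define R where "R = \<bar>q' - e 0\<bar> / ?w"
  have w: "?w > 0" using c_pos \<tau>_pos by simp
  have R: "R \<ge> 0" using w by (simp add: R_def)
  have wR: "?w * R = \<bar>q' - e 0\<bar>"
    unfolding R_def using w by (metis nonzero_mult_div_cancel_left less_irrefl times_divide_eq_right)
  have "e (- R) \<le> q'" "q' \<le> e R"
    using slope[of "- R" 0] slope[of 0 R] R wR
      abs_ge_self[of "q' - e 0"] abs_ge_minus_self[of "q' - e 0"] by (simp_all del: abs_ge_minus_self)
  then obtain p where "e p = q'" using IVT'[of e "- R" q' R] cont R by auto
  then show ?thesis using S[of p] unfolding e_def by (intro exI[of _ "S p"]) auto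
qed

lemma join_unique:
  assumes "is_sol u" "is_sol v" "fst (u s) = fst (v s)" "fst (u (s + \<tau>)) = fst (v (s + \<tau>))"
  shows "u = v"
proof (rule sol_unique[OF assms(1,2)])
  have "dp u v s = 0"
    using momentum_gap_bound[OF assms(1,2), of s s] assms(3,4) \<tau>_pos by (simp add: dq_def)
  then show "u s = v s" using assms(3) by (simp add: dp_def prod_eq_iff)
qed

text \<open>The choice is unique by \<open>join_unique\<close>. The momenta \<open>Y\<close> and \<open>Z\<close> at the two ends are, up to sign and
  the term \<open>F\<close>, the partial derivatives of the action of the step.\<close>

definition join :: "int \<Rightarrow> real \<Rightarrow> real \<Rightarrow> real \<Rightarrow> real \<times> real" where
  "join i q q' = (SOME u. is_sol u \<and> fst (u (node i)) = q \<and> fst (u (node (i + 1))) = q')"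

definition Y :: "int \<Rightarrow> real \<Rightarrow> real \<Rightarrow> real" where "Y i q q' = snd (join i q q' (node i))"
definition Z :: "int \<Rightarrow> real \<Rightarrow> real \<Rightarrow> real" where "Z i q q' = snd (join i q q' (node (i + 1)))"

lemma join_sol: "is_sol (join i q q')"
  and join_start: "join i q q' (node i) = (q, Y i q q')"
  and join_end: "join i q q' (node (i + 1)) = (q', Z i q q')"
  unfolding join_def Y_def Z_def
  using someI_ex[OF join_exists[of "node i" q q', folded node_Suc]] by (auto simp: prod_eq_iff)

lemma join_eqI:
  assumes "is_sol u" "fst (u (node i)) = q" "fst (u (node (i + 1))) = q'"
  shows "join i q q' = u"
  using join_unique[OF join_sol[of i q q'] assms(1), of "node i", folded node_Suc] assms(2,3)
  by (simp add: join_start join_end)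

lemma join_gaps:
  "dq (join i q q') (join i Q Q') (node i) = Q - q"
  "dq (join i q q') (join i Q Q') (node (i + 1)) = Q' - q'"
  "dp (join i q q') (join i Q Q') (node i) = Y i Q Q' - Y i q q'"
  "dp (join i q q') (join i Q Q') (node (i + 1)) = Z i Q Q' - Z i q q'"
  by (simp_all add: dq_def dp_def join_start join_end)

lemma nodes_in_step: "node i \<in> {node i..node i + \<tau>}" "node (i + 1) \<in> {node i..node i + \<tau>}"
  using \<tau>_pos by (simp_all add: node_Suc)

lemma Y_mono:
  assumes "q' \<le> Q'"
  shows "Y i q q' \<le> Y i q Q'"
proof (rule ccontr)
  assume "\<not> Y i q q' \<le> Y i q Q'"
  then have *: "0 < Y i q q' - Y i q Q'" by simp
  have "3 / 4 * c * \<tau> * (Y i q q' - Y i q Q') \<le> q' - Q'"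
    using twist[OF join_sol[of i q Q'] join_sol[of i q q'] nodes_in_step(1)[of i],
        folded node_Suc, unfolded join_gaps] * by simp
  moreover have "0 < 3 / 4 * c * \<tau> * (Y i q q' - Y i q Q')"
    using * c_pos \<tau>_pos by (intro mult_pos_pos) auto
  ultimately show False using assms by linarith
qed

lemma Z_antimono:
  assumes "q \<le> Q"
  shows "Z i Q q' \<le> Z i q q'"
proof (rule ccontr)
  assume "\<not> Z i Q q' \<le> Z i q q'"
  then have *: "0 < Z i Q q' - Z i q q'" by simp
  have "3 / 4 * c * \<tau> * (Z i Q q' - Z i q q') \<le> - (Q - q)"
    using twist[OF join_sol[of i q q'] join_sol[of i Q q'] nodes_in_step(2)[of i],
        folded node_Suc, unfolded join_gaps] * by simp
  moreover have "0 < 3 / 4 * c * \<tau> * (Z i Q q' - Z i q q')"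
    using * c_pos \<tau>_pos by (intro mult_pos_pos) auto
  ultimately show False using assms by linarith
qed

lemma Y_lipschitz: "\<bar>Y i Q Q' - Y i q q'\<bar> \<le> K * (\<bar>Q - q\<bar> + \<bar>Q' - q'\<bar>)"
  using momentum_gap_bound[OF join_sol[of i q q'] join_sol[of i Q Q'] nodes_in_step(1)[of i],
      folded node_Suc, unfolded join_gaps] .

lemma Z_lipschitz: "\<bar>Z i Q Q' - Z i q q'\<bar> \<le> K * (\<bar>Q - q\<bar> + \<bar>Q' - q'\<bar>)"
  using momentum_gap_bound[OF join_sol[of i q q'] join_sol[of i Q Q'] nodes_in_step(2)[of i],
      folded node_Suc, unfolded join_gaps] .

lemma f_per_multiple: "f (t + of_nat n * T) = f t"
proof (induction n)
  case (Suc n)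
  have "f (t + of_nat (Suc n) * T) = f ((t + of_nat n * T) + T)" by (simp add: algebra_simps)
  then show ?case by (simp only: f_per Suc)
qed simp

lemma F_per_multiple: "F (t + of_nat n * T) = F t"
proof (induction n)
  case (Suc n)
  have "F (t + of_nat (Suc n) * T) = F ((t + of_nat n * T) + T)" by (simp add: algebra_simps)
  then show ?case by (simp only: F_per Suc)
qed simp

lemma join_shift:
  "join (i + int (n * \<nu>)) (q + 2 * pi * of_int k) (q' + 2 * pi * of_int k) (t + of_nat n * T)
    = join i q q' t + (2 * pi * of_int k, 0)"
proof -
  let ?j = "join (i + int (n * \<nu>)) (q + 2 * pi * of_int k) (q' + 2 * pi * of_int k)"
  have n: "node (i + 1) + of_nat n * T = node (i + int (n * \<nu>) + 1)"
    "node i + of_nat n * T = node (i + int (n * \<nu>))"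
    using node_shift[of "i + 1" n] node_shift[of i n] by (simp_all add: ac_simps)
  have "is_sol (\<lambda>t. ?j (t + of_nat n * T) + (2 * pi * of_int (- k), 0))"
    by (rule sol_shift[OF join_sol f_per_multiple])
  then have "join i q q' = (\<lambda>t. ?j (t + of_nat n * T) + (2 * pi * of_int (- k), 0))"
    by (rule join_eqI) (auto simp: n join_start join_end)
  then have "join i q q' t = ?j (t + of_nat n * T) + (2 * pi * of_int (- k), 0)" by simp
  then show ?thesis by (simp add: prod_eq_iff)
qed

lemma YZ_shift:
  "Y (i + int (n * \<nu>)) (q + 2 * pi * of_int k) (q' + 2 * pi * of_int k) = Y i q q'"
  "Z (i + int (n * \<nu>)) (q + 2 * pi * of_int k) (q' + 2 * pi * of_int k) = Z i q q'"
proof -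
  have "node (i + 1) + of_nat n * T = node (i + int (n * \<nu>) + 1)"
    using node_shift[of "i + 1" n] by (simp add: ac_simps)
  then show
    "Y (i + int (n * \<nu>)) (q + 2 * pi * of_int k) (q' + 2 * pi * of_int k) = Y i q q'"
    "Z (i + int (n * \<nu>)) (q + 2 * pi * of_int k) (q' + 2 * pi * of_int k) = Z i q q'"
    using join_shift[of i n q k q' "node i"] join_shift[of i n q k q' "node (i + 1)"]
    unfolding Y_def Z_def by (simp_all only: node_shift plus_prod_def snd_conv add_0_right)
qed

end

section \<open>The action of one time step\<close>

lemma taylor_remainder_if_lipschitz_derivative:
  fixes G \<gamma> :: "real \<Rightarrow> real"
  assumes G: "\<And>x. (G has_real_derivative \<gamma> x) (at x)"
    and lip: "\<And>x y. \<bar>\<gamma> x - \<gamma> y\<bar> \<le> \<bar>x - y\<bar>"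
    and z: "z \<in> closed_segment x y"
  shows "\<bar>G y - G x - \<gamma> z * (y - x)\<bar> \<le> (y - x)\<^sup>2"
proof -
  have "norm ((G y - \<gamma> z * y) - (G x - \<gamma> z * x)) \<le> \<bar>y - x\<bar> * norm (y - x)"
  proof (rule field_differentiable_bound[of "closed_segment x y"])
    show "((\<lambda>t. G t - \<gamma> z * t) has_real_derivative \<gamma> t - \<gamma> z) (at t within closed_segment x y)" for t
      using has_field_derivative_at_within[OF G]
      by (auto intro!: derivative_eq_intros)
    show "norm (\<gamma> t - \<gamma> z) \<le> \<bar>y - x\<bar>" if "t \<in> closed_segment x y" for t
      using lip[of t z] that z by (auto simp: closed_segment_eq_real_ivl split: if_splits)
  qed auto
  then show ?thesis by (simp add: algebra_simps power2_eq_square flip: abs_mult)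
qed

context twist_system
begin

text \<open>The Lagrangian \<open>y q' - H\<close> in the coordinate \<open>y = p - F\<close>, expressed in \<open>q\<close> and \<open>p\<close>. Passing
  from \<open>p\<close> to \<open>y\<close> absorbs the forcing into the momentum; this makes the action of a time step
  invariant under the translation of positions by \<open>2 \<pi>\<close>.\<close>

definition lag :: "real \<Rightarrow> real \<times> real \<Rightarrow> real" where
  "lag t z = snd z * g (snd z) - \<Gamma> (snd z) - F t * g (snd z) + a * cos (fst z)"

definition h :: "int \<Rightarrow> real \<Rightarrow> real \<Rightarrow> real" where
  "h i q q' = integral {node i..node (i + 1)} (\<lambda>t. lag t (join i q q' t))"

lemma F_continuous: "continuous_on S F"
  using F_deriv DERIV_isCont continuous_at_imp_continuous_on by blast

lemma sol_continuous: "is_sol u \<Longrightarrow> continuous_on S u"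
  unfolding is_sol_def using has_vector_derivative_continuous continuous_at_imp_continuous_on by blast

lemma lag_continuous:
  assumes "is_sol u"
  shows "continuous_on S (\<lambda>t. lag t (u t))"
proof -
  have \<Gamma>: "continuous_on UNIV \<Gamma>"
    using \<Gamma>_deriv DERIV_isCont continuous_at_imp_continuous_on by blast
  then show ?thesis
    unfolding lag_def using sol_continuous[OF assms, of S]
    by (intro continuous_intros F_continuous continuous_on_compose2[OF g_continuous[of UNIV]]
        continuous_on_compose2[OF \<Gamma>]) auto
qed

lemma h_has_integral:
  "((\<lambda>t. lag t (join i q q' t)) has_integral h i q q') {node i..node (i + 1)}"
  unfolding h_def
  by (intro integrable_integral integrable_continuous_real lag_continuous join_sol)

lemma h_shift:
  "h (i + int (n * \<nu>)) (q + 2 * pi * of_int k) (q' + 2 * pi * of_int k) = h i q q'"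
proof -
  let ?j = "join (i + int (n * \<nu>)) (q + 2 * pi * of_int k) (q' + 2 * pi * of_int k)"
  have n: "node (i + int (n * \<nu>) + 1) = node (i + 1) + of_nat n * T"
    using node_shift[of "i + 1" n] by (simp add: ac_simps)
  have cos: "cos (x + 2 * pi * of_int k) = cos x" for x
    using cos_add[of x "2 * pi * of_int k"]
    by (metis cos_int_2pin diff_zero mult.commute mult.right_neutral mult_zero_right sin_int_2pin)
  have "h (i + int (n * \<nu>)) (q + 2 * pi * of_int k) (q' + 2 * pi * of_int k)
      = integral {node i + of_nat n * T..node (i + 1) + of_nat n * T} (\<lambda>t. lag t (?j t))"
    by (simp add: h_def n node_shift del: of_nat_mult)
  also have "\<dots> = integral {node i..node (i + 1)}
      (\<lambda>t. lag (t + of_nat n * T) (?j (t + of_nat n * T)))"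
    using integral_shift_real_ivl[of "node i + of_nat n * T" "of_nat n * T"
        "node (i + 1) + of_nat n * T" "\<lambda>t. lag t (?j t)"] by simp
  also have "\<dots> = h i q q'"
    unfolding h_def join_shift by (simp add: lag_def F_per_multiple cos)
  finally show ?thesis .
qed

definition K2 :: real where "K2 = 2 * \<tau> * (K\<^sup>2 + a * (1 + \<tau> * K)\<^sup>2)"

lemma K2_pos: "K2 > 0"
  using K_pos \<tau>_pos a_pos unfolding K2_def by (intro mult_pos_pos add_pos_nonneg) auto

text \<open>Hamilton's principle with a quadratic error: up to second order in the distance of the two
  solutions, the difference of their Lagrangians is the time derivative of \<open>(p - F) dq\<close>.\<close>

lemma h_expansion:
  "\<bar>h i Q Q' - h i q q' - ((Z i q q' - F (node (i + 1))) * (Q' - q') - (Y i q q' - F (node i)) * (Q - q))\<bar>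
    \<le> K2 * ((Q - q)\<^sup>2 + (Q' - q')\<^sup>2)"
proof -
  let ?I = "{node i..node (i + 1)}"
  define u where "u = join i q q'"
  define v where "v = join i Q Q'"
  have u: "is_sol u" and v: "is_sol v" by (simp_all add: u_def v_def join_sol)
  define E where "E = \<bar>Q - q\<bar> + \<bar>Q' - q'\<bar>"
  have I: "?I = {node i..node i + \<tau>}" by (simp add: node_Suc)
  have P: "\<bar>dp u v t\<bar> \<le> K * E" and X: "\<bar>dq u v t\<bar> \<le> (1 + \<tau> * K) * E" if "t \<in> ?I" for t
    using momentum_gap_bound[OF u v, of t "node i", folded node_Suc]
      position_gap_bound[OF u v, of t "node i", folded node_Suc] that
    by (simp_all add: u_def v_def join_gaps E_def)
  define w where "w t = (snd (u t) - F t) * dq u v t" for t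
  define w' where "w' t = (snd (u t) - F t) * (g (snd (v t)) - g (snd (u t)))
      - a * sin (fst (u t)) * dq u v t" for t
  have w: "(w has_real_derivative w' t) (at t)" for t
    unfolding w_def[abs_def] w'_def
    by (auto intro!: derivative_eq_intros sol_components[OF u] F_deriv dq_deriv[OF u v]
        simp: algebra_simps)
  have "(w' has_integral (w (node (i + 1)) - w (node i))) ?I"
  proof (rule fundamental_theorem_of_calculus)
    show "(w has_vector_derivative w' x) (at x within ?I)" for x
      using w by (simp add: has_real_derivative_iff_has_vector_derivative has_vector_derivative_at_within)
  qed (use \<tau>_pos in \<open>simp add: node_Suc\<close>)
  moreover have "w (node (i + 1)) = (Z i q q' - F (node (i + 1))) * (Q' - q')"
    "w (node i) = (Y i q q' - F (node i)) * (Q - q)"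
    unfolding w_def u_def v_def join_gaps by (simp_all add: join_start join_end)
  ultimately have int: "((\<lambda>t. lag t (v t) - lag t (u t) - w' t) has_integral
     (h i Q Q' - h i q q' - ((Z i q q' - F (node (i + 1))) * (Q' - q') - (Y i q q' - F (node i)) * (Q - q)))) ?I"
    unfolding u_def v_def by (auto intro!: has_integral_diff h_has_integral)
  define B where "B = (K * E)\<^sup>2 + a * ((1 + \<tau> * K) * E)\<^sup>2"
  have B0: "B \<ge> 0" using a_pos by (simp add: B_def)
  have pt: "\<bar>lag t (v t) - lag t (u t) - w' t\<bar> \<le> B" if "t \<in> ?I" for t
  proof -
    let ?p = "snd (u t)" and ?P = "snd (v t)" and ?x = "fst (u t)" and ?X = "fst (v t)"
    have "lag t (v t) - lag t (u t) - w' t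
        = - (\<Gamma> ?P - \<Gamma> ?p - g ?P * (?P - ?p)) + a * (cos ?X - cos ?x - (- sin ?x) * (?X - ?x))"
      by (simp add: lag_def w'_def dq_def algebra_simps)
    also have "\<bar>\<dots>\<bar> \<le> \<bar>\<Gamma> ?P - \<Gamma> ?p - g ?P * (?P - ?p)\<bar>
        + a * \<bar>cos ?X - cos ?x - (- sin ?x) * (?X - ?x)\<bar>"
      using a_pos by (intro order_trans[OF abs_triangle_ineq]) (simp add: abs_mult)
    also have "\<bar>\<Gamma> ?P - \<Gamma> ?p - g ?P * (?P - ?p)\<bar> \<le> (?P - ?p)\<^sup>2"
      by (rule taylor_remainder_if_lipschitz_derivative) (auto intro: \<Gamma>_deriv g_lip)
    also have "(?P - ?p)\<^sup>2 \<le> (K * E)\<^sup>2"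
      using P[OF that] by (intro power2_le_iff_abs_le[THEN iffD2]) (auto simp: dp_def K_pos less_imp_le E_def)
    also have "\<bar>cos ?X - cos ?x - (- sin ?x) * (?X - ?x)\<bar> \<le> (?X - ?x)\<^sup>2"
      by (rule taylor_remainder_if_lipschitz_derivative[where \<gamma> = "\<lambda>x. - sin x"])
        (use sin_lipschitz in \<open>auto simp: abs_minus_commute intro!: derivative_eq_intros\<close>)
    also have "(?X - ?x)\<^sup>2 \<le> ((1 + \<tau> * K) * E)\<^sup>2"
      using X[OF that] K_pos \<tau>_pos
      by (intro power2_le_iff_abs_le[THEN iffD2]) (auto simp: dq_def E_def)
    finally show ?thesis using a_pos by (simp add: B_def)
  qed
  have "norm (h i Q Q' - h i q q'
      - ((Z i q q' - F (node (i + 1))) * (Q' - q') - (Y i q q' - F (node i)) * (Q - q)))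
      \<le> B * measure lborel ?I"
    by (rule has_integral_bound_real[OF B0 finite.emptyI int]) (use pt in auto)
  also have "\<dots> = \<tau> * (K\<^sup>2 + a * (1 + \<tau> * K)\<^sup>2) * E\<^sup>2"
    unfolding I using \<tau>_pos
    by (simp add: B_def power_mult_distrib) (simp only: power_mult_distrib algebra_simps)
  also have "\<dots> \<le> \<tau> * (K\<^sup>2 + a * (1 + \<tau> * K)\<^sup>2) * (2 * ((Q - q)\<^sup>2 + (Q' - q')\<^sup>2))"
  proof (rule mult_left_mono)
    show "E\<^sup>2 \<le> 2 * ((Q - q)\<^sup>2 + (Q' - q')\<^sup>2)"
      using sum_squares_bound[of "\<bar>Q - q\<bar>" "\<bar>Q' - q'\<bar>"] by (simp add: E_def power2_sum)
  qed (use \<tau>_pos a_pos in simp)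
  finally show ?thesis by (simp add: K2_def algebra_simps)
qed

lemma h_continuous: "continuous_on S (\<lambda>x. h i (fst x) (snd x))"
proof (rule continuous_at_imp_continuous_on, rule ballI)
  fix z :: "real \<times> real"
  let ?A = "\<lambda>x. (Z i (fst z) (snd z) - F (node (i + 1))) * (snd x - snd z)
      - (Y i (fst z) (snd z) - F (node i)) * (fst x - fst z)"
  let ?R = "\<lambda>x. K2 * ((fst x - fst z)\<^sup>2 + (snd x - snd z)\<^sup>2)"
  have "((\<lambda>x. h i (fst x) (snd x) - h i (fst z) (snd z) - ?A x) \<longlongrightarrow> 0) (at z)"
  proof (rule Lim_null_comparison)
    show "\<forall>\<^sub>F x in at z. norm (h i (fst x) (snd x) - h i (fst z) (snd z) - ?A x) \<le> ?R x"
      unfolding real_norm_def by (intro always_eventually allI h_expansion)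
    have "(?R \<longlongrightarrow> K2 * ((fst z - fst z)\<^sup>2 + (snd z - snd z)\<^sup>2)) (at z)" by (intro tendsto_intros)
    then show "(?R \<longlongrightarrow> 0) (at z)" by simp
  qed
  moreover have "(?A \<longlongrightarrow> ?A z) (at z)" by (intro tendsto_intros)
  ultimately have "((\<lambda>x. (h i (fst x) (snd x) - h i (fst z) (snd z) - ?A x) + ?A x) \<longlongrightarrow> 0 + ?A z) (at z)"
    by (rule tendsto_add)
  then have "((\<lambda>x. h i (fst x) (snd x) - h i (fst z) (snd z)) \<longlongrightarrow> 0) (at z)" by simp
  then show "isCont (\<lambda>x. h i (fst x) (snd x)) z" unfolding isCont_def by (rule LIM_zero_cancel)
qed

text \<open>For \<open>0 \<le> s \<le> p\<close> the slope bound gives \<open>g s \<le> g p - c (p - s)\<close>, with the reverse inequality for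
  \<open>p \<le> s \<le> 0\<close>; integration of \<open>g\<close> from \<open>0\<close> to \<open>p\<close> yields the claim in both cases.\<close>

lemma kinetic_lower_bound: "c / 2 * p\<^sup>2 \<le> p * g p - \<Gamma> p + \<Gamma> 0"
proof -
  let ?d = "\<lambda>s. \<Gamma> s - s * g p + c * (p * s - s\<^sup>2 / 2)"
  have d: "(?d has_real_derivative g s - g p + c * (p - s)) (at s)" for s
    by (auto intro!: derivative_eq_intros \<Gamma>_deriv simp: algebra_simps)
  have "?d p \<le> ?d 0"
  proof (cases "p \<ge> 0")
    case True
    show ?thesis
    proof (rule DERIV_nonpos_imp_nonincreasing[OF True])
      fix x assume "0 \<le> x" "x \<le> p"
      then show "\<exists>y. (?d has_real_derivative y) (at x) \<and> y \<le> 0"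
        using d[of x] g_mono[of x p] by (intro exI conjI) auto
    qed
  next
    case False
    show ?thesis
    proof (rule DERIV_nonneg_imp_nondecreasing[of p 0 ?d])
      fix x assume x: "p \<le> x" "x \<le> 0"
      have "c * (p - x) = - (c * (x - p))" by (simp add: algebra_simps)
      then show "\<exists>y. (?d has_real_derivative y) (at x) \<and> 0 \<le> y"
        using d[of x] g_mono[of p x] x by (intro exI conjI) auto
    qed (use False in simp)
  qed
  then show ?thesis by (simp add: power2_eq_square algebra_simps)
qed

definition \<beta> :: real where "\<beta> = (BF + 1)\<^sup>2 / (2 * c) + a + \<bar>\<Gamma> 0\<bar>"

lemma lag_lower_bound: "\<bar>g (snd z)\<bar> - \<beta> \<le> lag t z"
proof -
  let ?p = "snd z"
  have gp: "\<bar>g ?p\<bar> \<le> \<bar>?p\<bar>" using g_lip[of ?p 0] by simp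
  have BF0: "BF \<ge> 0" using F_bound[of 0] by linarith
  have "0 \<le> (c * \<bar>?p\<bar> - (BF + 1))\<^sup>2 / (2 * c)" using c_pos by simp
  also have "\<dots> = c / 2 * ?p\<^sup>2 - (BF + 1) * \<bar>?p\<bar> + (BF + 1)\<^sup>2 / (2 * c)"
    using c_pos by (simp add: power2_diff power_mult_distrib field_simps)
      (simp add: power2_eq_square algebra_simps)
  finally have square: "(BF + 1) * \<bar>?p\<bar> \<le> c / 2 * ?p\<^sup>2 + (BF + 1)\<^sup>2 / (2 * c)" by simp
  have "\<bar>F t * g ?p\<bar> \<le> BF * \<bar>?p\<bar>"
    unfolding abs_mult using F_bound gp BF0 by (intro mult_mono) auto
  moreover have "- a \<le> a * cos (fst z)"
    using mult_left_mono[OF cos_ge_minus_one[of "fst z"], of a] a_pos by simp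
  ultimately have "c / 2 * ?p\<^sup>2 - \<Gamma> 0 - BF * \<bar>?p\<bar> - a \<le> lag t z"
    using kinetic_lower_bound[of ?p] unfolding lag_def by linarith
  then show ?thesis using square gp unfolding \<beta>_def by (simp add: algebra_simps)
qed

text \<open>Coercivity: a bound on the action of a broken solution is a bound on the variation of its
  positions.\<close>

lemma h_lower_bound: "\<bar>q' - q\<bar> - \<beta> * \<tau> \<le> h i q q'"
proof -
  let ?I = "{node i..node (i + 1)}"
  let ?u = "join i q q'"
  have "((\<lambda>t. g (snd (?u t))) has_integral (fst (?u (node (i + 1))) - fst (?u (node i)))) ?I"
  proof (rule fundamental_theorem_of_calculus)
    show "((\<lambda>t. fst (?u t)) has_vector_derivative g (snd (?u x))) (at x within ?I)" for x
      using sol_components(1)[OF join_sol]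
      by (simp add: has_real_derivative_iff_has_vector_derivative has_vector_derivative_at_within)
  qed (use \<tau>_pos in \<open>simp add: node_Suc\<close>)
  then have I: "((\<lambda>t. g (snd (?u t))) has_integral (q' - q)) ?I" by (simp add: join_start join_end)
  have "((\<lambda>t. lag t (?u t) + \<beta>) has_integral (h i q q' + \<beta> * \<tau>)) ?I"
    using has_integral_add[OF h_has_integral has_integral_const_real] \<tau>_pos
    by (fastforce simp: node_Suc mult.commute[of \<tau>])
  from has_integral_le[OF I this] has_integral_le[OF has_integral_neg[OF I] this]
  show ?thesis using lag_lower_bound by (smt (verit))
qed

end

section \<open>Broken solutions and the descent of their action\<close>

lemma compact_box: "compact {x :: int \<Rightarrow> real. \<forall>i. lo i \<le> x i \<and> x i \<le> hi i}"
proof -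
  have "compactin (product_topology (\<lambda>i::int. euclidean :: real topology) UNIV)
      (PiE UNIV (\<lambda>i. {lo i..hi i}))"
    unfolding compactin_PiE by simp
  moreover have "PiE UNIV (\<lambda>i. {lo i..hi i}) = {x. \<forall>i. lo i \<le> x i \<and> x i \<le> hi i}"
    by (auto simp: PiE_def Pi_def)
  ultimately show ?thesis by (simp add: euclidean_product_topology)
qed

lemma tendsto_coordinate:
  fixes x :: "nat \<Rightarrow> int \<Rightarrow> real"
  assumes "x \<longlonglongrightarrow> y"
  shows "(\<lambda>k. x k i) \<longlonglongrightarrow> y i"
proof -
  have "continuous_on UNIV (\<lambda>x :: int \<Rightarrow> real. x i)" by (rule continuous_on_product_coordinates)
  then show ?thesis using assms by (rule continuous_on_tendsto_compose) auto
qed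

lemma sum_shift_by_one:
  fixes A :: "int \<Rightarrow> real"
  assumes "A (int m) = A 0"
  shows "(\<Sum>j<m. A (int j + 1)) = (\<Sum>j<m. A (int j))"
proof -
  have "(\<Sum>j<m. A (int j + 1)) + A 0 = (\<Sum>j<m. A (int j)) + A (int m)"
    by (induction m) (auto simp: algebra_simps)
  then show ?thesis using assms by simp
qed

lemma periodic_mod:
  fixes A :: "int \<Rightarrow> 'b"
  assumes "\<And>i. A (i + m) = A i"
  shows "A (i mod m) = A i"
proof -
  have "A (i + m * k) = A i" for i k
  proof (induction k rule: int_induct[of _ 0])
    case (step1 k)
    then show ?case using assms[of "i + m * k"] by (simp add: algebra_simps)
  next
    case (step2 k)
    then show ?case using assms[of "i + m * (k - 1)"] by (simp add: algebra_simps)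
  qed simp
  from this[of "i mod m" "i div m"] show ?thesis by simp
qed

context twist_system
begin

text \<open>A sequence of positions at the nodes describes a broken solution; \<open>G\<close> is its jump of momentum,
  which is also the gradient of the action.\<close>

definition G :: "(int \<Rightarrow> real) \<Rightarrow> int \<Rightarrow> real" where
  "G q i = Z (i - 1) (q (i - 1)) (q i) - Y i (q i) (q (i + 1))"

definition trans :: "nat \<Rightarrow> int \<Rightarrow> (int \<Rightarrow> real) \<Rightarrow> int \<Rightarrow> real" where
  "trans n k q i = q (i + int (n * \<nu>)) + 2 * pi * of_int k"

definition winding :: "nat \<Rightarrow> int \<Rightarrow> (int \<Rightarrow> real) \<Rightarrow> bool" where
  "winding n R q \<longleftrightarrow> (\<forall>i. q (i + int (n * \<nu>)) = q i + 2 * pi * of_int R)"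

definition W :: "nat \<Rightarrow> (int \<Rightarrow> real) \<Rightarrow> real" where
  "W n q = (\<Sum>j<n * \<nu>. h (int j) (q (int j)) (q (int j + 1)))"

definition descend :: "real \<Rightarrow> (int \<Rightarrow> real) \<Rightarrow> int \<Rightarrow> real" where
  "descend e q i = q i - e * G q i"

text \<open>Small enough for gradient descent with a gradient whose quadratic error is \<open>K2\<close>, and small
  enough for \<open>q i - e * G q i\<close> to increase with \<open>q i\<close>, as \<open>G\<close> is \<open>2 K\<close>-Lipschitz in \<open>q i\<close>.\<close>

definition \<epsilon> :: real where "\<epsilon> = 1 / (4 * K2 + 2 * K)"

lemma \<epsilon>_pos: "\<epsilon> > 0" and \<epsilon>_K: "\<epsilon> * (2 * K) \<le> 1" and \<epsilon>_K2: "\<epsilon> * (2 * K2) \<le> 1 / 2"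
  using K_pos K2_pos by (simp_all add: \<epsilon>_def divide_simps add_pos_pos)

lemma winding_iff_trans: "winding n R q \<longleftrightarrow> trans n (- R) q = q"
proof -
  have "x = y + 2 * pi * of_int R \<longleftrightarrow> x + 2 * pi * of_int (- R) = y" for x y
    by auto
  then show ?thesis unfolding winding_def trans_def fun_eq_iff by blast
qed

lemma G_trans: "G (trans n k q) i = G q (i + int (n * \<nu>))"
proof -
  have "Y i (x + 2 * pi * of_int k) (y + 2 * pi * of_int k) = Y (i + int (n * \<nu>)) x y"
    "Z i (x + 2 * pi * of_int k) (y + 2 * pi * of_int k) = Z (i + int (n * \<nu>)) x y" for i x y
    using YZ_shift[of i 0 x k y] YZ_shift[of i n x 0 y] by simp_all
  moreover have "i - 1 + int (n * \<nu>) = i + int (n * \<nu>) - 1" "i + 1 + int (n * \<nu>) = i + int (n * \<nu>) + 1"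
    by simp_all
  ultimately show ?thesis unfolding G_def trans_def by (simp only:)
qed

lemma G_winding: "winding n R q \<Longrightarrow> G q (i + int (n * \<nu>)) = G q i"
  using G_trans[of n "- R" q i] by (simp add: winding_iff_trans)

lemma descend_trans: "descend e (trans n k q) = trans n k (descend e q)"
  by (auto simp: descend_def G_trans trans_def fun_eq_iff)

lemma descend_winding: "winding n R q \<Longrightarrow> winding n R (descend e q)"
  unfolding winding_iff_trans descend_trans[symmetric] by simp

lemma descend_pow_trans: "(descend e ^^ k) (trans n l q) = trans n l ((descend e ^^ k) q)"
  by (induction k) (simp_all add: descend_trans)

lemma descend_pow_winding: "winding n R q \<Longrightarrow> winding n R ((descend e ^^ k) q)"
  by (induction k) (simp_all add: descend_winding)

text \<open>Raising the neighbours of \<open>q i\<close> lowers \<open>Z\<close> and raises \<open>Y\<close>, hence lowers \<open>G q i\<close>; this makes the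
  descent order preserving.\<close>

lemma descend_mono:
  assumes "0 \<le> e" "e \<le> \<epsilon>" "q \<le> Q"
  shows "descend e q \<le> descend e Q"
proof (rule le_funI)
  fix i
  have le: "q j \<le> Q j" for j using \<open>q \<le> Q\<close> by (rule le_funD)
  have "G Q i \<le> Z (i - 1) (q (i - 1)) (Q i) - Y i (Q i) (q (i + 1))"
    unfolding G_def using Z_antimono[OF le] Y_mono[OF le] by (intro diff_mono)
  also have "\<dots> \<le> G q i + 2 * K * (Q i - q i)"
    using Z_lipschitz[of "i - 1" "q (i - 1)" "Q i" "q (i - 1)" "q i"]
      Y_lipschitz[of i "Q i" "q (i + 1)" "q i" "q (i + 1)"] le[of i]
    unfolding G_def by simp
  finally have "e * (G Q i - G q i) \<le> e * (2 * K * (Q i - q i))"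
    using \<open>0 \<le> e\<close> by (intro mult_left_mono) auto
  also have "\<dots> \<le> \<epsilon> * (2 * K * (Q i - q i))"
    using \<open>e \<le> \<epsilon>\<close> K_pos le[of i] by (intro mult_right_mono) auto
  also have "\<dots> = \<epsilon> * (2 * K) * (Q i - q i)" by simp
  also have "\<dots> \<le> 1 * (Q i - q i)"
    using \<epsilon>_K le[of i] by (intro mult_right_mono) auto
  finally show "descend e q i \<le> descend e Q i" by (simp add: descend_def algebra_simps)
qed

lemma descend_pow_mono: "q \<le> Q \<Longrightarrow> (descend \<epsilon> ^^ k) q \<le> (descend \<epsilon> ^^ k) Q"
  using \<epsilon>_pos by (induction k) (auto intro!: descend_mono)

lemma W_trans0: "W n (trans 0 k q) = W n q"
  using h_shift[of _ 0 _ k] by (simp add: W_def trans_def)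

text \<open>The linear parts of the expansions of consecutive time steps telescope to \<open>\<Sum> G \<delta>\<close>, because the
  terms with \<open>F\<close> cancel at every node.\<close>

lemma action_descends:
  assumes w: "winding n R q" and e: "0 \<le> e" "e \<le> \<epsilon>"
  shows "W n (descend e q) \<le> W n q - e / 2 * (\<Sum>j<n * \<nu>. (G q (int j))\<^sup>2)"
proof -
  let ?m = "n * \<nu>"
  define \<delta> where "\<delta> i = - e * G q i" for i
  define A where "A i = (Z (i - 1) (q (i - 1)) (q i) - F (node i)) * \<delta> i" for i
  define B where "B i = (Y i (q i) (q (i + 1)) - F (node i)) * \<delta> i" for i
  have \<delta>m: "\<delta> (int ?m) = \<delta> 0" using G_winding[OF w, of 0] by (simp add: \<delta>_def)
  have "Z (int ?m - 1) (q (int ?m - 1)) (q (int ?m)) = Z (- 1) (q (- 1)) (q 0)"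
    using YZ_shift(2)[of "-1" n "q (-1)" R "q 0"] w[unfolded winding_def, rule_format, of "-1"]
      w[unfolded winding_def, rule_format, of 0] by simp
  moreover have "F (node (int ?m)) = F (node 0)"
    using node_shift[of 0 n] F_per_multiple[of "node 0" n] by simp
  ultimately have Am: "A (int ?m) = A 0" unfolding A_def \<delta>m by simp
  have step: "h (int j) (descend e q (int j)) (descend e q (int j + 1))
      \<le> h (int j) (q (int j)) (q (int j + 1)) + (A (int j + 1) - B (int j))
        + K2 * ((\<delta> (int j))\<^sup>2 + (\<delta> (int j + 1))\<^sup>2)" for j
    using h_expansion[of "int j" "descend e q (int j)" "descend e q (int j + 1)"
        "q (int j)" "q (int j + 1)"]
    unfolding A_def B_def \<delta>_def descend_def by simp
  have "W n (descend e q) \<le> (\<Sum>j<?m. h (int j) (q (int j)) (q (int j + 1))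
      + (A (int j + 1) - B (int j)) + K2 * ((\<delta> (int j))\<^sup>2 + (\<delta> (int j + 1))\<^sup>2))"
    unfolding W_def by (intro sum_mono step)
  also have "\<dots> = W n q + ((\<Sum>j<?m. A (int j + 1)) - (\<Sum>j<?m. B (int j)))
      + K2 * ((\<Sum>j<?m. (\<delta> (int j))\<^sup>2) + (\<Sum>j<?m. (\<delta> (int j + 1))\<^sup>2))"
    unfolding W_def by (simp add: sum.distrib sum_subtractf sum_distrib_left distrib_left)
  also have "(\<Sum>j<?m. A (int j + 1)) = (\<Sum>j<?m. A (int j))"
    by (rule sum_shift_by_one[OF Am])
  also have "(\<Sum>j<?m. (\<delta> (int j + 1))\<^sup>2) = (\<Sum>j<?m. (\<delta> (int j))\<^sup>2)"
    by (rule sum_shift_by_one) (simp only: \<delta>m)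
  also have "(\<Sum>j<?m. A (int j)) - (\<Sum>j<?m. B (int j)) = - e * (\<Sum>j<?m. (G q (int j))\<^sup>2)"
    unfolding A_def B_def \<delta>_def sum_subtractf[symmetric] sum_distrib_left
    by (intro sum.cong refl) (simp add: G_def power2_eq_square algebra_simps)
  also have "(\<Sum>j<?m. (\<delta> (int j))\<^sup>2) = e\<^sup>2 * (\<Sum>j<?m. (G q (int j))\<^sup>2)"
    by (simp add: \<delta>_def power_mult_distrib sum_distrib_left)
  finally have *: "W n (descend e q)
      \<le> W n q - e * (\<Sum>j<?m. (G q (int j))\<^sup>2) + (e * (2 * K2)) * (e * (\<Sum>j<?m. (G q (int j))\<^sup>2))"
    by (simp add: power2_eq_square algebra_simps)
  have "e * (2 * K2) \<le> 1 / 2"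
    using mult_right_mono[OF e(2), of "2 * K2"] K2_pos \<epsilon>_K2 by linarith
  then have "(e * (2 * K2)) * (e * (\<Sum>j<?m. (G q (int j))\<^sup>2))
      \<le> 1 / 2 * (e * (\<Sum>j<?m. (G q (int j))\<^sup>2))"
    using e(1) by (intro mult_right_mono mult_nonneg_nonneg sum_nonneg) auto
  then show ?thesis using * by simp
qed

lemma action_descends_weak:
  assumes "winding n R q" "0 \<le> e" "e \<le> \<epsilon>"
  shows "W n (descend e q) \<le> W n q"
proof -
  have "0 \<le> e / 2 * (\<Sum>j<n * \<nu>. (G q (int j))\<^sup>2)"
    using assms(2) by (intro mult_nonneg_nonneg sum_nonneg) auto
  then show ?thesis using action_descends[OF assms] by linarith
qed

lemma action_decreasing:
  assumes "winding n R q"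
  shows "decseq (\<lambda>k. W n ((descend \<epsilon> ^^ k) q))"
  by (rule decseq_SucI)
    (use \<epsilon>_pos descend_pow_winding[OF assms] in \<open>auto intro!: action_descends_weak\<close>)

lemma W_continuous: "continuous_on S (W n)"
  unfolding W_def
  by (intro continuous_on_sum continuous_on_compose2[OF h_continuous[of UNIV], of S "\<lambda>q. (q _, q _)", simplified]
      continuous_intros continuous_on_subset[OF continuous_on_product_coordinates subset_UNIV])

lemma YZ_continuous:
  "continuous_on UNIV (\<lambda>x. Y i (fst x) (snd x))" "continuous_on UNIV (\<lambda>x. Z i (fst x) (snd x))"
proof -
  have *: "continuous_on UNIV \<phi>"
    if l: "\<And>x y. \<bar>\<phi> x - \<phi> y\<bar> \<le> K * (\<bar>fst x - fst y\<bar> + \<bar>snd x - snd y\<bar>)"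
    for \<phi> :: "real \<times> real \<Rightarrow> real"
  proof (rule lipschitz_on_continuous_on, rule lipschitz_onI)
    fix x y :: "real \<times> real"
    have "\<bar>fst x - fst y\<bar> \<le> norm (x - y)" "\<bar>snd x - snd y\<bar> \<le> norm (x - y)"
      using norm_fst_le[of "fst x - fst y" "snd x - snd y"]
        norm_snd_le[of "snd x - snd y" "fst x - fst y"]
      by (simp_all add: minus_prod_def)
    then have "K * (\<bar>fst x - fst y\<bar> + \<bar>snd x - snd y\<bar>) \<le> K * (norm (x - y) + norm (x - y))"
      using K_pos by (intro mult_left_mono) auto
    then show "dist (\<phi> x) (\<phi> y) \<le> (2 * K) * dist x y"
      using l[of x y] by (simp add: dist_norm)
  qed (use K_pos in simp)
  show "continuous_on UNIV (\<lambda>x. Y i (fst x) (snd x))" by (rule *) (rule Y_lipschitz)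
  show "continuous_on UNIV (\<lambda>x. Z i (fst x) (snd x))" by (rule *) (rule Z_lipschitz)
qed

lemma G_continuous: "continuous_on S (\<lambda>q. G q i)"
proof -
  have c: "continuous_on S (\<lambda>q :: int \<Rightarrow> real. (q j, q k))" for j k
    by (intro continuous_intros continuous_on_subset[OF continuous_on_product_coordinates subset_UNIV])
  show ?thesis
    unfolding G_def
    using continuous_on_compose2[OF YZ_continuous(1)[of i] c[of i "i + 1"]]
      continuous_on_compose2[OF YZ_continuous(2)[of "i - 1"] c[of "i - 1" i]]
    by (intro continuous_intros) auto
qed

lemma descend_continuous: "continuous_on S (descend e)"
proof (rule continuous_on_coordinatewise_then_product)
  show "continuous_on S (\<lambda>q. descend e q i)" for i
    unfolding descend_def
    by (intro continuous_intros G_continuous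
        continuous_on_subset[OF continuous_on_product_coordinates subset_UNIV])
qed

lemma descend_pow_continuous: "continuous_on S (descend e ^^ k)"
proof (induction k)
  case (Suc k)
  show ?case
    using continuous_on_compose[OF Suc descend_continuous] by (simp add: o_def)
qed (simp add: id_def)

lemma critical_if_no_descent:
  assumes w: "winding n R q" and "n > 0" and "W n q \<le> W n (descend \<epsilon> q)"
  shows "G q i = 0"
proof -
  have "\<epsilon> / 2 * (\<Sum>j<n * \<nu>. (G q (int j))\<^sup>2) \<le> 0"
    using action_descends[OF w, of \<epsilon>] \<epsilon>_pos assms(3) by simp
  then have "(\<Sum>j<n * \<nu>. (G q (int j))\<^sup>2) = 0"
    using \<epsilon>_pos by (intro antisym sum_nonneg) (auto simp: mult_le_0_iff)
  then have G0: "G q (int j) = 0" if "j < n * \<nu>" for j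
    using that by (subst (asm) sum_nonneg_eq_0_iff) auto
  have m: "int (n * \<nu>) > 0" using \<open>n > 0\<close> \<nu>_pos by simp
  define j where "j = nat (i mod int (n * \<nu>))"
  have j: "int j = i mod int (n * \<nu>)" using m by (simp add: j_def)
  then have "j < n * \<nu>" using m by (metis of_nat_less_iff pos_mod_bound)
  then have "G q (i mod int (n * \<nu>)) = 0" using G0 j by metis
  then show ?thesis
    using periodic_mod[of "G q" "int (n * \<nu>)" i] G_winding[OF w] by simp
qed

text \<open>Limit points of the descent are critical: the action tends to the action of a limit point, so
  one more step from there cannot lower the action.\<close>

lemma descent_limit:
  assumes w: "winding n R q" and "n > 0" and "compact C"
    and C: "\<And>k. \<exists>l. trans 0 l ((descend \<epsilon> ^^ k) q) \<in> C"
  shows "\<exists>Q l r. strict_mono (r :: nat \<Rightarrow> nat) \<and>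
     (\<lambda>k. trans 0 (l k) ((descend \<epsilon> ^^ r k) q)) \<longlonglongrightarrow> Q \<and> Q \<in> C \<and>
     winding n R Q \<and> (\<forall>i. G Q i = 0) \<and> (\<lambda>k. W n ((descend \<epsilon> ^^ k) q)) \<longlonglongrightarrow> W n Q"
proof -
  obtain l where l: "\<And>k. trans 0 (l k) ((descend \<epsilon> ^^ k) q) \<in> C" using C by metis
  define x where "x k = trans 0 (l k) ((descend \<epsilon> ^^ k) q)" for k
  obtain Q r where "Q \<in> C" and r: "strict_mono (r :: nat \<Rightarrow> nat)" and lim: "(x \<circ> r) \<longlonglongrightarrow> Q"
    using \<open>compact C\<close> l unfolding compact_def x_def by meson
  define e where "e k = W n ((descend \<epsilon> ^^ k) q)" for k
  have dec: "decseq e" unfolding e_def by (rule action_decreasing[OF w])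
  have Wx: "W n (x k) = e k" for k by (simp add: x_def e_def W_trans0)
  have WQ: "(\<lambda>k. e (r k)) \<longlonglongrightarrow> W n Q"
    using continuous_on_tendsto_compose[OF W_continuous[of UNIV n] lim] by (simp add: Wx)
  have low: "W n Q \<le> e k" for k
  proof (rule LIMSEQ_le_const2[OF WQ], intro exI[of _ k] allI impI)
    fix j assume "k \<le> j"
    then have "k \<le> r j" using seq_suble[OF r, of j] by linarith
    then show "e (r j) \<le> e k" using dec by (simp add: decseq_def)
  qed
  have xw: "winding n R (x k)" for k
    using descend_pow_winding[OF w, where e = \<epsilon> and k = k] by (simp add: x_def winding_def trans_def)
  have "winding n R Q"
    unfolding winding_def
  proof
    fix i
    have "(\<lambda>k. (x \<circ> r) k (i + int (n * \<nu>))) \<longlonglongrightarrow> Q i + 2 * pi * of_int R"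
      using xw tendsto_add[OF tendsto_coordinate[OF lim, of i] tendsto_const]
      by (simp add: winding_def o_def)
    then show "Q (i + int (n * \<nu>)) = Q i + 2 * pi * of_int R"
      using tendsto_coordinate[OF lim] LIMSEQ_unique by blast
  qed
  have "W n Q \<le> W n (descend \<epsilon> Q)"
  proof (rule LIMSEQ_le_const)
    have "continuous_on UNIV (\<lambda>q. W n (descend \<epsilon> q))"
      by (rule continuous_on_compose2[OF W_continuous[of UNIV] descend_continuous]) auto
    from continuous_on_tendsto_compose[OF this lim]
    show "(\<lambda>k. W n (descend \<epsilon> ((x \<circ> r) k))) \<longlonglongrightarrow> W n (descend \<epsilon> Q)" by simp
    have "W n (descend \<epsilon> (x k)) = e (Suc k)" for k
      by (simp add: x_def descend_trans W_trans0 e_def)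
    then show "\<exists>N. \<forall>k\<ge>N. W n Q \<le> W n (descend \<epsilon> ((x \<circ> r) k))" using low by simp
  qed
  then have "G Q i = 0" for i
    by (rule critical_if_no_descent[OF \<open>winding n R Q\<close> \<open>n > 0\<close>])
  moreover have "e \<longlonglongrightarrow> W n Q"
  proof -
    obtain L where L: "e \<longlonglongrightarrow> L" using decseq_convergent[OF dec] low by metis
    then have "(\<lambda>k. e (r k)) \<longlonglongrightarrow> L" using LIMSEQ_subseq_LIMSEQ[OF L r] by (simp add: o_def)
    then show ?thesis using WQ L LIMSEQ_unique by blast
  qed
  ultimately show ?thesis
    using r lim \<open>Q \<in> C\<close> \<open>winding n R Q\<close> unfolding x_def e_def o_def
    by (intro exI[of _ Q] exI[of _ "\<lambda>k. l (r k)"] exI[of _ r]) blast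
qed

section \<open>Critical broken solutions are solutions\<close>

text \<open>Without a jump of momentum at a node the two pieces that meet there belong to the same solution.\<close>

lemma critical_gives_solution:
  assumes crit: "\<And>i. G q i = 0"
  shows "\<exists>u. is_sol u \<and> (\<forall>i. u (node i) = (q i, Y i (q i) (q (i + 1))))"
proof -
  define J where "J i = join i (q i) (q (i + 1))" for i
  have step: "J (i + 1) = J i" for i
    unfolding J_def
    by (rule sol_unique[OF join_sol join_sol, of _ _ _ "node (i + 1)"])
      (use crit[of "i + 1"] in \<open>simp add: join_start join_end G_def\<close>)
  have "J i = J 0" for i
    using periodic_mod[of J 1 i] step by simp
  then have "J 0 (node i) = (q i, Y i (q i) (q (i + 1)))" for i
    using join_start[of i "q i" "q (i + 1)"] unfolding J_def by metis
  moreover have "is_sol (J 0)" unfolding J_def by (rule join_sol)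
  ultimately show ?thesis by blast
qed

lemma solution_gives_critical:
  assumes "is_sol u"
  shows "G (\<lambda>i. fst (u (node i))) i = 0"
proof -
  have j: "join i (fst (u (node i))) (fst (u (node (i + 1)))) = u" for i
    by (rule join_eqI[OF assms]) auto
  show ?thesis using j[of "i - 1"] j[of i] by (simp add: G_def Y_def Z_def)
qed

lemma solution_winding_iff:
  assumes u: "is_sol u"
  shows "winding n R (\<lambda>i. fst (u (node i)))
    \<longleftrightarrow> (\<forall>t. u (t + of_nat n * T) = u t + (2 * pi * of_int R, 0))"
proof
  assume w: "winding n R (\<lambda>i. fst (u (node i)))"
  define v where "v t = u (t + of_nat n * T) + (2 * pi * of_int (- R), 0)" for t
  have v: "is_sol v" unfolding v_def by (rule sol_shift[OF u f_per_multiple])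
  have "fst (u (node i)) = fst (v (node i))" for i
    using w[unfolded winding_def, rule_format, of i] unfolding v_def node_shift by simp
  then have "u = v"
    using join_unique[OF u v, of "node 0"] by (simp add: node_Suc[symmetric])
  show "\<forall>t. u (t + of_nat n * T) = u t + (2 * pi * of_int R, 0)"
  proof
    fix t
    have "u t = u (t + of_nat n * T) + (2 * pi * of_int (- R), 0)"
      using fun_cong[OF \<open>u = v\<close>, of t] by (simp only: v_def)
    then show "u (t + of_nat n * T) = u t + (2 * pi * of_int R, 0)"
      by (simp add: prod_eq_iff)
  qed
next
  assume "\<forall>t. u (t + of_nat n * T) = u t + (2 * pi * of_int R, 0)"
  then show "winding n R (\<lambda>i. fst (u (node i)))"
    unfolding winding_def node_shift by simp
qed

section \<open>Ordered critical sequences of every winding number\<close>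

lemma winding_mult:
  assumes "winding n R x"
  shows "x i = x (i mod int (n * \<nu>)) + 2 * pi * of_int R * of_int (i div int (n * \<nu>))"
proof (cases "n * \<nu> = 0")
  case False
  define m where "m = int (n * \<nu>)"
  have m: "m > 0" using False unfolding m_def by (simp only: of_nat_0_less_iff)
  define A where "A i = x i - 2 * pi * of_int R * of_int (i div m)" for i
  have "A (i + m) = A i" for i
    using assms[unfolded winding_def, rule_format, of i] m unfolding A_def m_def[symmetric]
    by (simp add: algebra_simps)
  from periodic_mod[of A, OF this, of i] show ?thesis
    using m unfolding A_def m_def[symmetric] by simp
next
  case True
  then have "int (n * \<nu>) = 0" by (simp only: of_nat_0)
  then show ?thesis by (simp only: div_by_0 mod_by_0 of_int_0 mult_zero_right add_0_right)
qed

text \<open>The descent from an equidistant sequence stays bounded up to translations by \<open>2 \<pi>\<close>, because the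
  action controls the variation; and it stays ordered with respect to its own shift by one period,
  because the descent is monotone and commutes with shifts.\<close>

lemma ordered_critical_exists:
  assumes "n > 0" and R: "int n * N \<le> R"
  shows "\<exists>q. winding n R q \<and> q \<le> trans 1 (- N) q \<and> (\<forall>i. G q i = 0)"
proof -
  define m where "m = n * \<nu>"
  have m: "m > 0" using \<open>n > 0\<close> \<nu>_pos by (simp add: m_def)
  define q0 where "q0 i = 2 * pi * of_int R * of_int i / of_nat m" for i :: int
  have w0: "winding n R q0"
    using m unfolding winding_def m_def[symmetric] by (simp add: q0_def field_simps)
  have ord0: "q0 \<le> trans 1 (- N) q0"
  proof (rule le_funI)
    fix i
    have "of_int (int n * N) \<le> (of_int R :: real)" using R by (simp only: of_int_le_iff)
    then have "2 * pi * of_int N * n \<le> 2 * pi * of_int R"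
      using pi_gt_zero by (simp add: mult.commute)
    then have "2 * pi * of_int N \<le> 2 * pi * of_int R / n"
      using \<open>n > 0\<close> by (simp add: pos_le_divide_eq)
    moreover have "q0 (i + int \<nu>) = q0 i + 2 * pi * of_int R / n"
      using \<open>n > 0\<close> \<nu>_pos by (simp add: q0_def m_def field_simps)
    ultimately show "q0 i \<le> trans 1 (- N) q0 i"
      by (simp add: trans_def)
  qed
  define x where "x k = (descend \<epsilon> ^^ k) q0" for k
  have xw: "winding n R (x k)" for k unfolding x_def by (rule descend_pow_winding[OF w0])
  have xo: "x k \<le> trans 1 (- N) (x k)" for k
    using descend_pow_mono[OF ord0, of k] by (simp add: x_def descend_pow_trans)
  define B where "B = W n q0 + m * (\<beta> * \<tau>)"
  have var: "\<bar>x k (int j) - x k 0\<bar> \<le> B" if "j \<le> m" for j k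
  proof -
    have "W n (x k) \<le> W n q0"
      using decseqD[OF action_decreasing[OF w0], of 0 k] by (simp add: x_def)
    have tele: "\<bar>x k (int j) - x k 0\<bar> \<le> (\<Sum>i<j. \<bar>x k (int i + 1) - x k (int i)\<bar>)"
    proof (induction j)
      case (Suc j)
      have "int (Suc j) = int j + 1" by simp
      then show ?case using Suc by (simp only: sum.lessThan_Suc)
    qed simp
    also have "\<dots> \<le> (\<Sum>i<m. \<bar>x k (int i + 1) - x k (int i)\<bar>)"
      using that by (intro sum_mono2) auto
    also have "\<dots> \<le> (\<Sum>i<m. h (int i) (x k (int i)) (x k (int i + 1)) + \<beta> * \<tau>)"
      using h_lower_bound by (intro sum_mono) (simp add: algebra_simps)
    also have "\<dots> = W n (x k) + m * (\<beta> * \<tau>)"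
      by (simp add: W_def sum.distrib m_def)
    finally show ?thesis using \<open>W n (x k) \<le> W n q0\<close> by (simp add: B_def)
  qed
  define C where "C = {z :: int \<Rightarrow> real. \<forall>i.
     2 * pi * of_int R * of_int (i div int m) - B \<le> z i \<and>
     z i \<le> 2 * pi * of_int R * of_int (i div int m) + (2 * pi + B)}"
  have "compact C" unfolding C_def by (rule compact_box)
  have inC: "\<exists>l. trans 0 l (x k) \<in> C" for k
  proof -
    define d where "d = \<lfloor>x k 0 / (2 * pi)\<rfloor>"
    have "of_int d \<le> x k 0 / (2 * pi)" "x k 0 / (2 * pi) < of_int d + 1"
      unfolding d_def by linarith+
    then have "of_int d * (2 * pi) \<le> x k 0" "x k 0 < (of_int d + 1) * (2 * pi)"
      by (simp_all only: pos_le_divide_eq[of "2 * pi"] pos_divide_less_eq[of "2 * pi"] pi_gt_zero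
          mult_pos_pos zero_less_numeral)
    moreover define l where "l = - d"
    ultimately have l: "0 \<le> x k 0 + 2 * pi * of_int l" "x k 0 + 2 * pi * of_int l \<le> 2 * pi"
      by (simp_all add: algebra_simps)
    have "trans 0 l (x k) \<in> C"
      unfolding C_def
    proof (rule CollectI, rule allI)
      fix i
      define j where "j = nat (i mod int m)"
      have j: "int j = i mod int m" using m by (simp add: j_def)
      then have "j \<le> m" using m pos_mod_bound[of "int m" i] by linarith
      from var[OF this, of k]
      show "2 * pi * of_int R * of_int (i div int m) - B \<le> trans 0 l (x k) i \<and>
        trans 0 l (x k) i \<le> 2 * pi * of_int R * of_int (i div int m) + (2 * pi + B)"
        using l winding_mult[OF xw, of k i, folded m_def] unfolding j
        by (simp add: trans_def) linarith
    qed
    then show ?thesis by blast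
  qed
  obtain Q l r where lim: "(\<lambda>k. trans 0 (l k) (x (r k))) \<longlonglongrightarrow> Q"
    and Q: "winding n R Q" "\<And>i. G Q i = 0"
    using descent_limit[OF w0 \<open>n > 0\<close> \<open>compact C\<close> inC[unfolded x_def]] unfolding x_def by blast
  have "Q \<le> trans 1 (- N) Q"
  proof (rule le_funI)
    fix i
    have "(\<lambda>k. trans 0 (l k) (x (r k)) (i + int (1 * \<nu>)) + 2 * pi * of_int (- N))
        \<longlonglongrightarrow> Q (i + int (1 * \<nu>)) + 2 * pi * of_int (- N)"
      by (intro tendsto_add tendsto_coordinate[OF lim] tendsto_const)
    then show "Q i \<le> trans 1 (- N) Q i"
      unfolding trans_def[of 1]
    proof (rule LIMSEQ_le[OF tendsto_coordinate[OF lim]], intro exI[of _ 0] allI impI)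
      fix k
      show "trans 0 (l k) (x (r k)) i \<le>
          trans 0 (l k) (x (r k)) (i + int (1 * \<nu>)) + 2 * pi * of_int (- N)"
        using le_funD[OF xo, of "r k" i] by (simp add: trans_def)
    qed
  qed
  then show ?thesis using Q by blast
qed

section \<open>A second critical sequence\<close>

lemma closed_winding: "closed {x. winding n R x}"
  unfolding winding_def
  by (intro closed_Collect_all closed_Collect_eq continuous_intros continuous_on_product_coordinates)

text \<open>A mountain pass without deformations. If \<open>q\<close> were the only critical sequence up to translation,
  then the action along every descent in the order interval between \<open>q\<close> and \<open>q + 2 \<pi>\<close> would tend to
  the action of \<open>q\<close>. The middle slice of the interval would lie strictly above that level, so the
  descents would eventually stay on one side of it. Being on a given side is an open condition,
  which is impossible along the segment from \<open>q\<close> to \<open>q + 2 \<pi>\<close>.\<close>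

lemma second_critical_exists:
  assumes w: "winding n R q" and "n > 0" and crit: "\<And>i. G q i = 0"
  shows "\<exists>Q. winding n R Q \<and> (\<forall>i. G Q i = 0) \<and> (\<forall>k. Q \<noteq> trans 0 k q)"
proof (rule ccontr)
  assume "\<not> ?thesis"
  then have only: "\<exists>k. Q = trans 0 k q" if "winding n R Q" "\<And>i. G Q i = 0" for Q
    using that by blast
  define p where "p = q 0 + pi"
  define C where "C = {x. \<forall>i. q i \<le> x i \<and> x i \<le> q i + 2 * pi}"
  have "compact C" unfolding C_def by (rule compact_box)
  have C_iff: "x \<in> C \<longleftrightarrow> q \<le> x \<and> x \<le> trans 0 1 q" for x
    by (auto simp: C_def le_fun_def trans_def)
  have fix1: "descend e q = q" for e by (simp add: descend_def crit fun_eq_iff)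
  have DC: "descend e x \<in> C" if "x \<in> C" "0 \<le> e" "e \<le> \<epsilon>" for e x
    using descend_mono[OF that(2,3), of q x] descend_mono[OF that(2,3), of x "trans 0 1 q"] that(1)
    unfolding C_iff descend_trans fix1 by blast
  have DkC: "(descend \<epsilon> ^^ k) x \<in> C" if "x \<in> C" for x k
    using that \<epsilon>_pos by (induction k) (auto intro!: DC)
  have tends: "(\<lambda>k. W n ((descend \<epsilon> ^^ k) x)) \<longlonglongrightarrow> W n q" if x: "x \<in> C" "winding n R x" for x
  proof -
    have "\<exists>l. trans 0 l ((descend \<epsilon> ^^ k) x) \<in> C" for k
      using DkC[OF x(1), of k] by (intro exI[of _ 0]) (simp add: trans_def[abs_def])
    from descent_limit[OF x(2) \<open>n > 0\<close> \<open>compact C\<close> this] obtain Q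
      where "winding n R Q" "\<And>i. G Q i = 0" and lim: "(\<lambda>k. W n ((descend \<epsilon> ^^ k) x)) \<longlonglongrightarrow> W n Q"
      by blast
    then obtain k where "Q = trans 0 k q" using only by blast
    then show ?thesis using lim by (simp add: W_trans0)
  qed
  define S where "S = C \<inter> ({x. winding n R x} \<inter> {x. x 0 = p})"
  define \<sigma> where "\<sigma> s i = q i + 2 * pi * s" for s :: real and i
  have \<sigma>w: "winding n R (\<sigma> s)" for s using w by (simp add: winding_def \<sigma>_def)
  have \<sigma>C: "\<sigma> s \<in> C" if "0 \<le> s" "s \<le> 1" for s
    using that pi_gt_zero mult_left_mono[of s 1 "2 * pi"] by (simp add: C_def \<sigma>_def)
  have "compact S"
    unfolding S_def
    by (intro compact_Int_closed \<open>compact C\<close> closed_Int closed_winding closed_Collect_eq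
        continuous_on_product_coordinates continuous_intros)
  moreover have "\<sigma> (1 / 2) \<in> S"
    unfolding S_def using \<sigma>C[of "1 / 2"] \<sigma>w by (simp add: \<sigma>_def p_def)
  ultimately obtain xm where xm: "xm \<in> S" and xmin: "\<And>x. x \<in> S \<Longrightarrow> W n xm \<le> W n x"
    using continuous_attains_inf[OF _ _ W_continuous[of S n]] by blast
  have xm': "xm \<in> C" "winding n R xm" "xm 0 = p" using xm by (auto simp: S_def)
  have above: "W n q < W n xm"
  proof (rule ccontr)
    assume "\<not> W n q < W n xm"
    moreover have "W n q \<le> W n (descend \<epsilon> xm)"
      using decseq_ge[OF action_decreasing[OF xm'(2)] tends[OF xm'(1,2)], of 1] by simp
    ultimately have "W n xm \<le> W n (descend \<epsilon> xm)" by linarith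
    then have "\<And>i. G xm i = 0" by (rule critical_if_no_descent[OF xm'(2) \<open>n > 0\<close>])
    then obtain k where "xm = trans 0 k q" using only[OF xm'(2)] by blast
    then have "2 * pi * of_int k = pi * 1" using xm'(3) by (simp add: trans_def p_def)
    then have "real_of_int (2 * k) = of_int 1" by simp
    then have "2 * k = 1" by (simp only: of_int_eq_iff)
    then show False by presburger
  qed
  have off: "x 0 \<noteq> p" if "x \<in> C" "winding n R x" "W n x < W n xm" for x
    using xmin[of x] that by (auto simp: S_def)
  \<comment> \<open>A step could jump over the slice, but the shorter steps \<open>descend e\<close> with \<open>0 \<le> e \<le> \<epsilon>\<close> interpolate it
      and do not raise the action either.\<close>
  have same_side: "0 < (x 0 - p) * (descend \<epsilon> x 0 - p)"
    if x: "x \<in> C" "winding n R x" "W n x < W n xm" for x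
  proof (rule ccontr)
    let ?d = "x 0 - p" and ?g = "G x 0"
    assume "\<not> 0 < ?d * (descend \<epsilon> x 0 - p)"
    then have le: "?d * ?d \<le> \<epsilon> * (?d * ?g)" by (simp add: descend_def algebra_simps)
    have "0 < ?d * ?d" using off[OF x] by (simp flip: power2_eq_square)
    with le have dg: "0 < ?d * ?g" using \<epsilon>_pos by (smt (verit) mult_nonneg_nonpos)
    then have g0: "?g \<noteq> 0" and d0: "?d \<noteq> 0" by auto
    define e where "e = ?d / ?g"
    have e: "e = (?d * ?d) / (?d * ?g)" using d0 by (simp add: e_def)
    have "0 \<le> e" unfolding e using dg by (intro divide_nonneg_pos) auto
    moreover have "e \<le> \<epsilon>" unfolding e using dg le by (simp only: pos_divide_le_eq)
    ultimately have "descend e x \<in> C" "W n (descend e x) \<le> W n x"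
      using DC[OF x(1)] action_descends_weak[OF x(2)] by blast+
    moreover have "descend e x 0 = p" using g0 by (simp add: descend_def e_def)
    ultimately show False using off[OF _ descend_winding[OF x(2)], of e] x(3) by linarith
  qed
  define low where "low s k \<longleftrightarrow> W n ((descend \<epsilon> ^^ k) (\<sigma> s)) < W n xm" for s k
  have stay: "low s (k + i) \<and> 0 < ((descend \<epsilon> ^^ k) (\<sigma> s) 0 - p) * ((descend \<epsilon> ^^ (k + i)) (\<sigma> s) 0 - p)"
    if "low s k" "0 \<le> s" "s \<le> 1" for s k i
  proof (induction i)
    case 0
    have "(descend \<epsilon> ^^ k) (\<sigma> s) 0 \<noteq> p"
      using off[OF DkC[OF \<sigma>C[OF that(2,3)]] descend_pow_winding[OF \<sigma>w]] that(1) by (simp add: low_def)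
    then have "0 < ((descend \<epsilon> ^^ k) (\<sigma> s) 0 - p)\<^sup>2" by simp
    then show ?case using that(1) by (simp add: power2_eq_square)
  next
    case (Suc i)
    let ?x = "(descend \<epsilon> ^^ (k + i)) (\<sigma> s)"
    have x: "?x \<in> C" "winding n R ?x" "W n ?x < W n xm"
      using DkC[OF \<sigma>C[OF that(2,3)]] descend_pow_winding[OF \<sigma>w] Suc by (auto simp: low_def)
    have "low s (k + Suc i)"
      using action_descends_weak[OF x(2), of \<epsilon>] x(3) \<epsilon>_pos by (simp add: low_def)
    moreover have "0 < ((descend \<epsilon> ^^ k) (\<sigma> s) 0 - p) * (descend \<epsilon> ?x 0 - p)"
      using same_side[OF x] Suc by (auto simp: zero_less_mult_iff)
    ultimately show ?case by simp
  qed
  define A1 where "A1 = (\<Union>k. {s. low s k} \<inter> {s. (descend \<epsilon> ^^ k) (\<sigma> s) 0 < p})"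
  define A2 where "A2 = (\<Union>k. {s. low s k} \<inter> {s. p < (descend \<epsilon> ^^ k) (\<sigma> s) 0})"
  have c\<sigma>: "continuous_on UNIV (\<lambda>s. (descend \<epsilon> ^^ k) (\<sigma> s))" for k
  proof -
    have "continuous_on UNIV \<sigma>"
      unfolding \<sigma>_def by (intro continuous_on_coordinatewise_then_product continuous_intros)
    then show ?thesis by (intro continuous_on_compose2[OF descend_pow_continuous]) auto
  qed
  have c0: "continuous_on UNIV (\<lambda>s. (descend \<epsilon> ^^ k) (\<sigma> s) 0)" for k
    using continuous_on_product_then_coordinatewise[OF c\<sigma>] .
  have open_low: "open {s. low s k}" for k
    unfolding low_def
    by (intro open_Collect_less continuous_on_const continuous_on_compose2[OF W_continuous c\<sigma>]) auto
  have "open A1" "open A2"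
    unfolding A1_def A2_def
    by (intro open_UN ballI open_Int open_low open_Collect_less c0 continuous_on_const)+
  moreover have "{0..1} \<subseteq> A1 \<union> A2"
  proof
    fix s :: real assume s: "s \<in> {0..1}"
    then have sC: "\<sigma> s \<in> C" using \<sigma>C by simp
    obtain k where k: "low s k"
      using order_tendstoD(2)[OF tends[OF sC \<sigma>w] above]
      unfolding low_def eventually_sequentially by blast
    then have "(descend \<epsilon> ^^ k) (\<sigma> s) 0 \<noteq> p"
      using off[OF DkC[OF sC] descend_pow_winding[OF \<sigma>w]] by (simp add: low_def)
    then show "s \<in> A1 \<union> A2" using k unfolding A1_def A2_def by fastforce
  qed
  moreover have "A1 \<inter> A2 \<inter> {0..1} = {}"
  proof (rule ccontr)
    assume "A1 \<inter> A2 \<inter> {0..1} \<noteq> {}"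
    then obtain s k l where s: "0 \<le> s" "s \<le> 1"
      and k: "low s k" "(descend \<epsilon> ^^ k) (\<sigma> s) 0 < p"
      and l: "low s l" "p < (descend \<epsilon> ^^ l) (\<sigma> s) 0"
      unfolding A1_def A2_def by auto
    show False
      using stay[OF k(1) s, of l] stay[OF l(1) s, of k] k(2) l(2)
      by (simp add: zero_less_mult_iff add.commute)
  qed
  moreover have "0 \<in> A1"
    unfolding A1_def low_def using above pi_gt_zero
    by (intro UN_I[of 0]) (auto simp: \<sigma>_def[abs_def] p_def)
  moreover have "1 \<in> A2"
  proof -
    have "\<sigma> 1 = trans 0 1 q" by (simp add: \<sigma>_def trans_def fun_eq_iff)
    then show ?thesis
      unfolding A2_def low_def using above pi_gt_zero
      by (intro UN_I[of 0]) (auto simp: W_trans0 trans_def p_def)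
  qed
  ultimately show False
    using connectedD[OF connected_Icc[of 0 "1::real"], of A1 A2] by force
qed

end

section \<open>Drifting solutions that almost close up\<close>

context forced_system
begin

text \<open>By the mean value theorem the velocity is below \<open>v\<close> at some time of the window, where the momentum
  is then at most \<open>P\<close>; from there the force changes it by at most \<open>a + Bf\<close> per unit of time.\<close>

lemma momentum_bounded_if_slow:
  assumes u: "is_sol u" and "L > 0"
    and fast: "\<And>p. \<bar>p\<bar> > P \<Longrightarrow> \<bar>g p\<bar> > v"
    and slow: "\<bar>fst (u (s + L)) - fst (u s)\<bar> < v * L"
    and t: "s \<le> t" "t \<le> s + L"
  shows "\<bar>snd (u t)\<bar> \<le> P + (a + Bf) * L"
proof -
  obtain r where r: "s < r" "r < s + L"
    and "fst (u (s + L)) - fst (u s) = (s + L - s) * g (snd (u r))"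
    using MVT2[of s "s + L" "\<lambda>t. fst (u t)" "\<lambda>t. g (snd (u t))"] sol_components(1)[OF u] \<open>L > 0\<close>
    by auto
  then have "L * \<bar>g (snd (u r))\<bar> < L * v"
    using slow \<open>L > 0\<close> by (simp add: abs_mult mult.commute)
  then have "\<bar>snd (u r)\<bar> \<le> P" using fast[of "snd (u r)"] \<open>L > 0\<close> by fastforce
  moreover have "\<bar>snd (u t) - snd (u r)\<bar> \<le> (a + Bf) * \<bar>t - r\<bar>"
  proof -
    have "\<bar>- a * sin x + f t\<bar> \<le> a + Bf" for x t
    proof -
      have "\<bar>a * sin x\<bar> \<le> a * 1" using a_pos by (simp add: abs_mult mult_left_le)
      then show ?thesis using f_bound[of t] by simp
    qed
    then show ?thesis
      using field_differentiable_bound[of UNIV "\<lambda>t. snd (u t)"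
          "\<lambda>t. - a * sin (fst (u t)) + f t" "a + Bf" t r] sol_components(2)[OF u]
      by simp
  qed
  moreover have "(a + Bf) * \<bar>t - r\<bar> \<le> (a + Bf) * L"
    using t r a_pos f_bound[of 0] by (intro mult_left_mono) auto
  ultimately show ?thesis by linarith
qed

end

context twist_system
begin

text \<open>Where two solutions with ordered positions come close in position, the twist forces them to be
  close in momentum: a larger gap of momenta would make the positions cross at a neighbouring
  node.\<close>

lemma ordered_momentum_gap:
  assumes u: "is_sol u" and v: "is_sol v"
    and ord: "\<And>i. fst (u (node i)) \<le> fst (v (node i))"
  shows "\<bar>snd (v (node i)) - snd (u (node i))\<bar> \<le> K * (fst (v (node i)) - fst (u (node i)))"
proof -
  let ?q = "\<lambda>i. fst (u (node i))" and ?Q = "\<lambda>i. fst (v (node i))"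
  have ju: "join i (?q i) (?q (i + 1)) = u" and jv: "join i (?Q i) (?Q (i + 1)) = v" for i
    by (rule join_eqI; simp add: u v)+
  have Y: "snd (u (node i)) = Y i (?q i) (?q (i + 1))" "snd (v (node i)) = Y i (?Q i) (?Q (i + 1))"
    by (simp_all add: Y_def ju jv)
  have Z: "snd (u (node i)) = Z (i - 1) (?q (i - 1)) (?q i)"
    "snd (v (node i)) = Z (i - 1) (?Q (i - 1)) (?Q i)"
    using ju[of "i - 1"] jv[of "i - 1"] by (simp_all add: Z_def)
  have "Y i (?Q i) (?Q (i + 1)) \<ge> Y i (?Q i) (?q (i + 1))" by (rule Y_mono[OF ord])
  moreover have "Z (i - 1) (?Q (i - 1)) (?Q i) \<le> Z (i - 1) (?q (i - 1)) (?Q i)"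
    by (rule Z_antimono[OF ord])
  ultimately show ?thesis
    using Y_lipschitz[of i "?Q i" "?q (i + 1)" "?q i" "?q (i + 1)"]
      Z_lipschitz[of "i - 1" "?q (i - 1)" "?Q i" "?q (i - 1)" "?q i"] Y Z ord[of i]
    by simp
qed

text \<open>An ordered solution that gains one extra turn in \<open>n\<close> periods gains it in \<open>n\<close> nonnegative
  instalments \<open>\<gamma> 0 (k + 1) - \<gamma> 0 k\<close>. One of them is at most \<open>2 \<pi> / n\<close>, and the order turns this into
  closeness of the phase points at the two ends of that period. Time and position are then
  translated so that this period becomes the first one. The bound on partial advances, which is
  uniform in \<open>n\<close>, serves to bound the momentum.\<close>

lemma drifting_solution_exists:
  assumes "n > 0"
  shows "\<exists>u. is_sol u \<and> 0 \<le> fst (u 0) \<and> fst (u 0) \<le> 2 * pi \<and>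
    u (of_nat n * T) = u 0 + (2 * pi * (of_nat n * of_int N + 1), 0) \<and>
    (\<forall>i. \<forall>j\<le>n. \<bar>fst (u (node i + of_nat j * T)) - fst (u (node i)) - 2 * pi * of_nat j * of_int N\<bar> \<le> 2 * pi) \<and>
    norm (u T - (2 * pi * of_int N, 0) - u 0) \<le> (1 + K) * (2 * pi / of_nat n)"
proof -
  obtain q where w: "winding n (int n * N + 1) q" and ord: "q \<le> trans 1 (- N) q"
    and crit: "\<And>i. G q i = 0"
    using ordered_critical_exists[OF \<open>n > 0\<close>, of N "int n * N + 1"] by auto
  obtain w where w_sol: "is_sol w" and w_node: "\<And>i. w (node i) = (q i, Y i (q i) (q (i + 1)))"
    using critical_gives_solution[OF crit] by blast
  define \<gamma> where "\<gamma> i k = q (i + int (k * \<nu>)) - 2 * pi * of_nat k * of_int N" for i k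
  have mono: "\<gamma> i k \<le> \<gamma> i (Suc k)" for i k
    using le_funD[OF ord, of "i + int (k * \<nu>)"]
    by (simp add: \<gamma>_def trans_def algebra_simps)
  have \<gamma>n: "\<gamma> i n = \<gamma> i 0 + 2 * pi" for i
    using w[unfolded winding_def, rule_format, of i] by (simp add: \<gamma>_def algebra_simps)
  have mono': "\<gamma> i k \<le> \<gamma> i l" if "k \<le> l" for i k l
    using lift_Suc_mono_le[of "\<gamma> i", OF mono that] .
  have "\<exists>k<n. \<gamma> 0 (Suc k) - \<gamma> 0 k \<le> 2 * pi / n"
  proof (rule ccontr)
    assume "\<not> ?thesis"
    then have "2 * pi / n < \<gamma> 0 (Suc k) - \<gamma> 0 k" if "k < n" for k using that by force
    then have "(\<Sum>k<n. 2 * pi / n) < (\<Sum>k<n. \<gamma> 0 (Suc k) - \<gamma> 0 k)"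
      using \<open>n > 0\<close> by (intro sum_strict_mono) auto
    also have "\<dots> = 2 * pi" using \<gamma>n[of 0] by (simp add: sum_lessThan_telescope)
    finally show False using \<open>n > 0\<close> by simp
  qed
  then obtain k where k: "\<gamma> 0 (Suc k) - \<gamma> 0 k \<le> 2 * pi / n" by blast
  define d where "d = \<lfloor>q (int (k * \<nu>)) / (2 * pi)\<rfloor>"
  have "of_int d \<le> q (int (k * \<nu>)) / (2 * pi)" "q (int (k * \<nu>)) / (2 * pi) < of_int d + 1"
    unfolding d_def by linarith+
  then have d: "of_int d * (2 * pi) \<le> q (int (k * \<nu>))" "q (int (k * \<nu>)) < (of_int d + 1) * (2 * pi)"
    by (simp_all only: pos_le_divide_eq[of "2 * pi"] pos_divide_less_eq[of "2 * pi"] pi_gt_zero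
        mult_pos_pos zero_less_numeral)
  define u where "u t = w (t + of_nat k * T) + (2 * pi * of_int (- d), 0)" for t
  have u: "is_sol u" unfolding u_def by (rule sol_shift[OF w_sol f_per_multiple])
  have q_u: "fst (u (node i)) = q (i + int (k * \<nu>)) - 2 * pi * of_int d" for i
    unfolding u_def node_shift[symmetric] w_node by simp
  have node0: "node 0 = 0" by (simp add: node_def)
  have w': "winding n (int n * N + 1) (\<lambda>i. fst (u (node i)))"
    using w unfolding winding_def q_u by (metis (no_types, opaque_lifting) add.assoc add.commute add_diff_eq diff_add_eq)
  have gap: "fst (u (node i + of_nat j * T)) - fst (u (node i)) - 2 * pi * of_nat j * of_int N
      = \<gamma> i (k + j) - \<gamma> i k" for i j
    unfolding node_shift[symmetric] q_u \<gamma>_def by (simp add: algebra_simps)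
  show ?thesis
  proof (intro exI[of _ u] conjI u allI impI)
    show "0 \<le> fst (u 0)" "fst (u 0) \<le> 2 * pi"
      using d q_u[of 0] by (simp_all add: node0 algebra_simps)
    show "u (of_nat n * T) = u 0 + (2 * pi * (of_nat n * of_int N + 1), 0)"
      using w'[unfolded solution_winding_iff[OF u], rule_format, of 0] by simp
    show "\<bar>fst (u (node i + of_nat j * T)) - fst (u (node i)) - 2 * pi * of_nat j * of_int N\<bar> \<le> 2 * pi"
      if "j \<le> n" for i j
    proof -
      have "\<gamma> i (k + n) - \<gamma> i k = 2 * pi"
        using \<gamma>n[of "i + int (k * \<nu>)"] by (simp add: \<gamma>_def algebra_simps)
      then show ?thesis
        unfolding gap using mono'[of k "k + j" i] mono'[of "k + j" "k + n" i] that by simp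
    qed
    define v where "v t = u (t + of_nat 1 * T) + (2 * pi * of_int (- N), 0)" for t
    have v: "is_sol v" unfolding v_def by (rule sol_shift[OF u f_per_multiple])
    have vu: "fst (v (node i)) - fst (u (node i)) = \<gamma> i (k + 1) - \<gamma> i k" for i
      using gap[of i 1] by (simp add: v_def)
    have "fst (u (node i)) \<le> fst (v (node i))" for i
      using vu[of i] mono'[of k "k + 1" i] by simp
    from ordered_momentum_gap[OF u v this, of 0]
    have p: "\<bar>snd (v 0) - snd (u 0)\<bar> \<le> K * (fst (v 0) - fst (u 0))" by (simp only: node0)
    have x: "0 \<le> fst (v 0) - fst (u 0)" "fst (v 0) - fst (u 0) \<le> 2 * pi / n"
      using vu[of 0] k mono[of 0 k] by (simp_all add: node0)
    have "u T - (2 * pi * of_int N, 0) - u 0 = (fst (v 0) - fst (u 0), snd (v 0) - snd (u 0))"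
      by (simp add: v_def prod_eq_iff)
    also have "norm \<dots> \<le> \<bar>fst (v 0) - fst (u 0)\<bar> + \<bar>snd (v 0) - snd (u 0)\<bar>"
      using norm_Pair_le by (metis real_norm_def)
    also have "\<dots> \<le> (1 + K) * (fst (v 0) - fst (u 0))"
      using p x by (simp add: algebra_simps)
    also have "\<dots> \<le> (1 + K) * (2 * pi / n)"
      using x K_pos by (intro mult_left_mono) auto
    finally show "norm (u T - (2 * pi * of_int N, 0) - u 0) \<le> (1 + K) * (2 * pi / of_nat n)" .
  qed
qed

end

section \<open>The relativistic velocity and its cut-off\<close>

definition velocity :: "real \<Rightarrow> real" where "velocity p = p / sqrt (1 + p\<^sup>2)"

definition slope :: "real \<Rightarrow> real" where "slope p = 1 / ((1 + p\<^sup>2) * sqrt (1 + p\<^sup>2))"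

lemma one_plus_square_pos: "0 < 1 + (p::real)\<^sup>2"
  by (simp add: add_pos_nonneg)

lemma velocity_deriv: "(velocity has_real_derivative slope p) (at p)"
proof -
  have pos: "0 < 1 + p\<^sup>2" by (rule one_plus_square_pos)
  have "(velocity has_real_derivative
      (1 * sqrt (1 + p\<^sup>2) - p * ((2 * p) * (inverse (sqrt (1 + p\<^sup>2)) / 2)))
        / (sqrt (1 + p\<^sup>2) * sqrt (1 + p\<^sup>2))) (at p)"
    unfolding velocity_def[abs_def] using pos
    by (auto intro!: derivative_eq_intros)
  moreover have "(1 * sqrt (1 + p\<^sup>2) - p * ((2 * p) * (inverse (sqrt (1 + p\<^sup>2)) / 2)))
        / (sqrt (1 + p\<^sup>2) * sqrt (1 + p\<^sup>2)) = slope p"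
  proof -
    define r where "r = sqrt (1 + p\<^sup>2)"
    have r: "r > 0" "r * r = 1 + p\<^sup>2" using pos by (simp_all add: r_def)
    have "(1 * r - p * ((2 * p) * (inverse r / 2))) = (r * r - p\<^sup>2) / r"
      using r(1) by (simp add: field_simps power2_eq_square)
    also have "\<dots> = 1 / r" using r by simp
    finally show ?thesis using r unfolding slope_def r_def[symmetric] by simp
  qed
  ultimately show ?thesis by simp
qed

lemma slope_bounds: "0 < slope p" "slope p \<le> 1"
proof -
  have "1 \<le> (1 + p\<^sup>2) * sqrt (1 + p\<^sup>2)" using mult_mono[of 1 "1 + p\<^sup>2" 1 "sqrt (1 + p\<^sup>2)"] by simp
  then show "0 < slope p" "slope p \<le> 1"
    unfolding slope_def by (simp_all add: one_plus_square_pos)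
qed

lemma slope_antimono: "\<bar>p\<bar> \<le> M \<Longrightarrow> slope M \<le> slope p"
proof -
  assume "\<bar>p\<bar> \<le> M"
  then have "p\<^sup>2 \<le> M\<^sup>2" by (simp add: abs_le_square_iff[symmetric])
  then have "(1 + p\<^sup>2) * sqrt (1 + p\<^sup>2) \<le> (1 + M\<^sup>2) * sqrt (1 + M\<^sup>2)"
    by (intro mult_mono) auto
  then show ?thesis
    unfolding slope_def by (intro divide_left_mono) (auto simp: one_plus_square_pos)
qed

lemma velocity_increment:
  assumes "p \<le> P"
  shows "0 \<le> velocity P - velocity p" "velocity P - velocity p \<le> P - p"
    and "\<lbrakk>\<bar>p\<bar> \<le> M; \<bar>P\<bar> \<le> M\<rbrakk> \<Longrightarrow> slope M * (P - p) \<le> velocity P - velocity p"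
proof -
  obtain x where x: "p \<le> x" "x \<le> P" "velocity P - velocity p = (P - p) * slope x"
    using MVT2[of p P velocity slope] velocity_deriv assms
    by (cases "p = P") (auto simp: order_le_less)
  show "0 \<le> velocity P - velocity p" "velocity P - velocity p \<le> P - p"
    using x(3) assms slope_bounds[of x] by (simp_all add: mult_left_le less_imp_le)
  show "slope M * (P - p) \<le> velocity P - velocity p" if "\<bar>p\<bar> \<le> M" "\<bar>P\<bar> \<le> M"
    using mult_left_mono[OF slope_antimono[of x M], of "P - p"] x that assms
    by (simp add: mult.commute)
qed

lemma velocity_lipschitz: "\<bar>velocity P - velocity p\<bar> \<le> \<bar>P - p\<bar>"
  using velocity_increment(1,2)[of p P] velocity_increment(1,2)[of P p]
  by (cases "p \<le> P") auto

lemma velocity_minus: "velocity (- p) = - velocity p"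
  by (simp add: velocity_def)

lemma velocity_square: "1 - (velocity p)\<^sup>2 = 1 / (1 + p\<^sup>2)"
  using one_plus_square_pos[of p] by (simp add: velocity_def power_divide field_simps)

lemma velocity_less_1: "\<bar>velocity p\<bar> < 1"
proof -
  have "(velocity p)\<^sup>2 < 1"
    using velocity_square[of p] one_plus_square_pos[of p] by (smt (verit) divide_pos_pos)
  then show ?thesis by (simp add: abs_square_less_1)
qed

lemma velocity_surj:
  assumes "0 \<le> v" "v < 1"
  shows "velocity (v / sqrt (1 - v\<^sup>2)) = v"
proof -
  define r where "r = sqrt (1 - v\<^sup>2)"
  have "v\<^sup>2 < 1" using assms by (simp add: power_less_one_iff abs_square_less_1)
  then have r: "r > 0" "r\<^sup>2 = 1 - v\<^sup>2" by (simp_all add: r_def)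
  have "1 + (v / r)\<^sup>2 = 1 / r\<^sup>2" using r by (simp add: power_divide field_simps)
  then have "sqrt (1 + (v / r)\<^sup>2) = 1 / r" using r(1) by (simp add: real_sqrt_divide)
  then show ?thesis using r(1) unfolding velocity_def r_def[symmetric] by simp
qed

text \<open>The velocity continued with slope \<open>1\<close> outside \<open>[- M, M]\<close>.\<close>

definition clamp_to :: "real \<Rightarrow> real \<Rightarrow> real" where "clamp_to M p = max (- M) (min M p)"

definition cut_velocity :: "real \<Rightarrow> real \<Rightarrow> real" where
  "cut_velocity M p = velocity (clamp_to M p) + (p - clamp_to M p)"

lemma cut_velocity_eq: "\<bar>p\<bar> \<le> M \<Longrightarrow> cut_velocity M p = velocity p"
  by (simp add: cut_velocity_def clamp_to_def)

lemma cut_velocity_increment: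
  assumes "p \<le> P" "M \<ge> 0"
  shows "slope M * (P - p) \<le> cut_velocity M P - cut_velocity M p"
    and "cut_velocity M P - cut_velocity M p \<le> P - p"
proof -
  let ?p = "clamp_to M p" and ?P = "clamp_to M P"
  have c: "?p \<le> ?P" "?P - ?p \<le> P - p" "\<bar>?p\<bar> \<le> M" "\<bar>?P\<bar> \<le> M"
    using assms by (auto simp: clamp_to_def)
  have "slope M * ((P - p) - (?P - ?p)) \<le> 1 * ((P - p) - (?P - ?p))"
    using c slope_bounds(2)[of M] by (intro mult_right_mono) auto
  then show "slope M * (P - p) \<le> cut_velocity M P - cut_velocity M p"
    using velocity_increment(3)[OF c(1,3,4)] by (simp add: cut_velocity_def algebra_simps)
  show "cut_velocity M P - cut_velocity M p \<le> P - p"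
    using velocity_increment(2)[OF c(1)] by (simp add: cut_velocity_def)
qed

lemma cut_velocity_lipschitz:
  assumes "M \<ge> 0"
  shows "\<bar>cut_velocity M P - cut_velocity M p\<bar> \<le> \<bar>P - p\<bar>"
proof -
  have "0 \<le> slope M * (P - p)" if "p \<le> P" for p P
    using that slope_bounds(1)[of M] by simp
  then show ?thesis
    using cut_velocity_increment[of p P M] cut_velocity_increment[of P p M] assms
    by (cases "p \<le> P") (force, smt (verit))
qed

lemma cut_velocity_fast:
  assumes "0 \<le> P" "P \<le> M" "\<bar>p\<bar> > P"
  shows "\<bar>cut_velocity M p\<bar> > velocity P"
proof -
  have strict: "cut_velocity M x < cut_velocity M y" if "x < y" for x y
  proof -
    have "0 < slope M * (y - x)" using that slope_bounds(1)[of M] by (intro mult_pos_pos) auto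
    then show ?thesis using cut_velocity_increment(1)[of x y M] that assms by linarith
  qed
  show ?thesis
    using strict[of P p] strict[of p "- P"] assms cut_velocity_eq[of P M] cut_velocity_eq[of "- P" M]
    by (auto simp: velocity_minus abs_if split: if_splits)
qed

lemma velocity_fast:
  assumes "0 \<le> P" "\<bar>p\<bar> > P"
  shows "\<bar>velocity p\<bar> > velocity P"
  using cut_velocity_fast[of P "\<bar>p\<bar>" p] cut_velocity_eq[of p "\<bar>p\<bar>"] assms by simp

section \<open>The Poincare map of the relativistic pendulum\<close>

locale relativistic_system = forced_system a f velocity Bf for a f Bf +
  fixes T :: real and N :: int
  assumes T_positive: "T > 0" and f_periodic: "\<And>t. f (t + T) = f t"
begin

lemma is_sol_iff: "is_sol u \<longleftrightarrow> system_solution a f u"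
  by (simp add: is_sol_def system_solution_def field_def velocity_def)

lemma trajectory_eqI:
  assumes "is_sol u"
  shows "trajectory a f (u 0) = u"
  unfolding trajectory_def is_sol_iff[symmetric]
proof (rule the_equality)
  show "v = u" if "is_sol v \<and> v 0 = u 0" for v
    by (rule sol_unique[of v u 0]) (use that assms in auto)
qed (simp add: assms)

lemma trajectory_sol: "is_sol (trajectory a f z)" and trajectory_start: "trajectory a f z 0 = z"
proof -
  obtain u where u: "u 0 = z" "is_sol u" using sol_exists[of 0 z] by blast
  then have "trajectory a f z = u" using trajectory_eqI[of u] by simp
  then show "is_sol (trajectory a f z)" "trajectory a f z 0 = z" by (simp_all add: u)
qed

lemma poincare_map_eq:
  "poincare_map a f T N z = trajectory a f z T - (2 * pi * of_int N, 0)"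
  by (simp add: poincare_map_def prod_eq_iff)

lemma poincare_map_sol:
  "is_sol u \<Longrightarrow> poincare_map a f T N (u 0) = u T - (2 * pi * of_int N, 0)"
  by (simp add: poincare_map_eq trajectory_eqI)

lemma poincare_map_pow_sol:
  assumes "is_sol u"
  shows "(poincare_map a f T N ^^ k) (u 0) = u (of_nat k * T) - (2 * pi * of_nat k * of_int N, 0)"
  using assms
proof (induction k arbitrary: u)
  case 0
  then show ?case by (simp add: zero_prod_def[symmetric])
next
  case (Suc k)
  define v where "v t = u (t + T) + (2 * pi * of_int (- N), 0)" for t
  have v: "is_sol v" unfolding v_def by (rule sol_shift[OF Suc.prems f_periodic])
  have v0: "poincare_map a f T N (u 0) = v 0"
    by (simp add: poincare_map_sol[OF Suc.prems] v_def prod_eq_iff)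
  have "(poincare_map a f T N ^^ Suc k) (u 0) = (poincare_map a f T N ^^ k) (v 0)"
    by (simp only: funpow_Suc_right o_apply v0)
  also have "\<dots> = v (of_nat k * T) - (2 * pi * of_nat k * of_int N, 0)" by (rule Suc.IH[OF v])
  also have "\<dots> = u (of_nat (Suc k) * T) - (2 * pi * of_nat (Suc k) * of_int N, 0)"
    by (simp add: v_def prod_eq_iff algebra_simps)
  finally show ?case .
qed

lemma poincare_map_lipschitz:
  "norm (poincare_map a f T N z - poincare_map a f T N z') \<le> exp ((1 + a) * T) * norm (z - z')"
  using sol_gronwall[OF trajectory_sol[of z] trajectory_sol[of z'], of T 0] T_positive
  by (simp add: poincare_map_eq trajectory_start)

lemma poincare_map_tendsto:
  assumes "z \<longlonglongrightarrow> l"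
  shows "(\<lambda>k. poincare_map a f T N (z k)) \<longlonglongrightarrow> poincare_map a f T N l"
proof -
  have "(\<lambda>k. poincare_map a f T N (z k) - poincare_map a f T N l) \<longlonglongrightarrow> 0"
  proof (rule Lim_null_comparison)
    show "\<forall>\<^sub>F k in sequentially. norm (poincare_map a f T N (z k) - poincare_map a f T N l)
        \<le> exp ((1 + a) * T) * norm (z k - l)"
      by (intro always_eventually allI poincare_map_lipschitz)
    show "(\<lambda>k. exp ((1 + a) * T) * norm (z k - l)) \<longlonglongrightarrow> 0"
      using assms by (intro tendsto_mult_right_zero tendsto_norm_zero) (simp add: LIM_zero)
  qed
  then show ?thesis by (rule LIM_zero_cancel)
qed

lemma fixed_point_winding:
  assumes u: "is_sol u" and "poincare_map a f T N (u 0) = u 0"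
  shows "u (t + T) = u t + (2 * pi * of_int N, 0)"
proof -
  define v where "v t = u (t + T) + (2 * pi * of_int (- N), 0)" for t
  have v: "is_sol v" unfolding v_def by (rule sol_shift[OF u f_periodic])
  have "v 0 = u 0" using assms(2) poincare_map_sol[OF u] by (simp add: v_def prod_eq_iff)
  then have "v = u" by (rule sol_unique[OF v u])
  then have "v t = u t" by simp
  then show ?thesis by (simp add: v_def prod_eq_iff)
qed

text \<open>Under stability of the limit fixed point, an orbit that starts close to it could not advance
  by \<open>2 \<pi>\<close>.\<close>

lemma unstable_if_drifting_orbits_accumulate:
  assumes z: "z \<longlonglongrightarrow> l" and fp: "poincare_map a f T N l = l"
    and m: "\<And>k. m k > 0"
    and drift: "\<And>k. (poincare_map a f T N ^^ m k) (z k) = z k + (2 * pi, 0)"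
  shows "unstable_fixed_point UNIV (poincare_map a f T N) l"
proof -
  have "\<not> liapunov_stable UNIV (poincare_map a f T N) l"
  proof
    assume "liapunov_stable UNIV (poincare_map a f T N) l"
    then have "l \<in> interior (ball l pi) \<longrightarrow> (\<exists>U. l \<in> interior U \<and> U \<subseteq> ball l pi \<and>
        (\<forall>n>0. (\<forall>k<n. (poincare_map a f T N ^^ k) ` U \<subseteq> UNIV) \<and> (poincare_map a f T N ^^ n) ` U \<subseteq> ball l pi))"
      unfolding liapunov_stable_def by (rule spec)
    moreover have "l \<in> interior (ball l pi)" by simp
    ultimately have "\<exists>U. l \<in> interior U \<and> U \<subseteq> ball l pi \<and>
        (\<forall>n>0. (\<forall>k<n. (poincare_map a f T N ^^ k) ` U \<subseteq> UNIV) \<and> (poincare_map a f T N ^^ n) ` U \<subseteq> ball l pi)"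
      by (rule mp)
    then obtain U where U: "l \<in> interior U" "U \<subseteq> ball l pi"
      and inv': "\<forall>n>0. (\<forall>k<n. (poincare_map a f T N ^^ k) ` U \<subseteq> UNIV) \<and> (poincare_map a f T N ^^ n) ` U \<subseteq> ball l pi"
      by (elim exE conjE)
    have inv: "(poincare_map a f T N ^^ n) ` U \<subseteq> ball l pi" if "n > 0" for n
      using inv'[rule_format, OF that] by (rule conjunct2)
    have "\<forall>\<^sub>F k in sequentially. z k \<in> interior U"
      by (rule topological_tendstoD[OF z open_interior U(1)])
    then obtain k where "z k \<in> interior U" unfolding eventually_sequentially by blast
    then have k: "z k \<in> U" using interior_subset by blast
    then have "(poincare_map a f T N ^^ m k) (z k) \<in> ball l pi" using inv[OF m] by blast
    then have "z k + (2 * pi, 0) \<in> ball l pi" by (simp only: drift)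
    moreover have "z k \<in> ball l pi" using k U(2) by blast
    ultimately have "dist l (z k) < pi" "dist l (z k + (2 * pi, 0)) < pi" by (simp_all only: mem_ball)
    then have "dist (z k) (z k + (2 * pi, 0)) < 2 * pi"
      using dist_triangle3[of "z k" "z k + (2 * pi, 0)" l] by linarith
    moreover have "dist (z k) (z k + (2 * pi, 0)) = 2 * pi"
      using pi_gt_zero by (simp add: dist_norm norm_Pair real_sqrt_mult)
    ultimately show False by simp
  qed
  then show ?thesis using fp by (simp add: unstable_fixed_point_def)
qed

lemma position_deriv: "is_sol u \<Longrightarrow> deriv (\<lambda>t. fst (u t)) t = velocity (snd (u t))"
  by (rule DERIV_imp_deriv[OF sol_components(1)])

lemma momentum_position:
  assumes "is_sol u"
  shows "momentum (\<lambda>t. fst (u t)) = (\<lambda>t. snd (u t))"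
proof
  fix t
  define p where "p = snd (u t)"
  have "sqrt (1 - (velocity p)\<^sup>2) = 1 / sqrt (1 + p\<^sup>2)"
    by (simp add: velocity_square real_sqrt_divide)
  moreover have "sqrt (1 + p\<^sup>2) > 0" by (simp add: one_plus_square_pos)
  ultimately show "momentum (\<lambda>t. fst (u t)) t = snd (u t)"
    unfolding momentum_def position_deriv[OF assms] p_def[symmetric]
    by (simp add: velocity_def)
qed

lemma position_is_solution:
  assumes u: "is_sol u"
  shows "is_solution a f (\<lambda>t. fst (u t))"
proof -
  have cq: "continuous_on UNIV (\<lambda>t. fst (u t))" and cp: "continuous_on UNIV (\<lambda>t. snd (u t))"
    using sol_components[OF u] DERIV_isCont continuous_at_imp_continuous_on by blast+
  have "(\<lambda>t. fst (u t)) C1_differentiable_on UNIV"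
    unfolding C1_differentiable_on_def
    using sol_components(1)[OF u] continuous_on_compose2[OF g_continuous[of UNIV] cp]
    by (intro exI[of _ "\<lambda>t. velocity (snd (u t))"])
      (simp add: has_real_derivative_iff_has_vector_derivative)
  moreover have "(\<lambda>t. snd (u t)) C1_differentiable_on UNIV"
    unfolding C1_differentiable_on_def
  proof (intro exI[of _ "\<lambda>t. - a * sin (fst (u t)) + f t"] conjI ballI)
    show "continuous_on UNIV (\<lambda>t. - a * sin (fst (u t)) + f t)"
      by (intro continuous_intros cq f_cont)
  qed (use sol_components(2)[OF u] in \<open>simp add: has_real_derivative_iff_has_vector_derivative\<close>)
  moreover have "deriv (\<lambda>t. snd (u t)) t = - a * sin (fst (u t)) + f t" for t
    by (rule DERIV_imp_deriv[OF sol_components(2)[OF u]])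
  ultimately show ?thesis
    unfolding is_solution_def momentum_position[OF u] position_deriv[OF u]
    by (simp add: velocity_less_1)
qed

end

section \<open>Two solutions, one of them unstable\<close>

lemma periodic_continuous_bounded:
  fixes f :: "real \<Rightarrow> real"
  assumes "continuous_on UNIV f" and per: "\<And>t. f (t + T) = f t" and "T > 0"
  shows "\<exists>B. \<forall>t. \<bar>f t\<bar> \<le> B"
proof -
  have per': "f (t + of_int k * T) = f t" for t k
  proof (induction k rule: int_induct[of _ 0])
    case (step1 k)
    have "f (t + of_int (k + 1) * T) = f ((t + of_int k * T) + T)" by (simp add: algebra_simps)
    then show ?case using step1 by (simp only: per)
  next
    case (step2 k)
    have "f (t + of_int k * T) = f ((t + of_int (k - 1) * T) + T)" by (simp add: algebra_simps)
    then show ?case using step2 by (simp only: per)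
  qed simp
  have "continuous_on {0..T} f" using assms(1) continuous_on_subset by blast
  then have "bounded (f ` {0..T})" by (intro compact_imp_bounded compact_continuous_image) auto
  then obtain B where "\<forall>y\<in>f ` {0..T}. norm y \<le> B" unfolding bounded_iff by blast
  then have B: "\<bar>f t\<bar> \<le> B" if "t \<in> {0..T}" for t using that by auto
  have "\<bar>f t\<bar> \<le> B" for t
  proof -
    define k where "k = \<lfloor>t / T\<rfloor>"
    have "of_int k \<le> t / T" "t / T < of_int k + 1" unfolding k_def by linarith+
    then have "t - of_int k * T \<in> {0..T}"
      using \<open>T > 0\<close> by (simp add: pos_le_divide_eq pos_divide_less_eq algebra_simps)
    from B[OF this] show ?thesis using per'[of "t - of_int k * T" k] by simp
  qed
  then show ?thesis by blast
qed

theorem theorem1: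
  fixes a T :: real and f :: "real \<Rightarrow> real" and N :: int
  assumes "a > 0" and "T > 0"
    and "continuous_on UNIV f"
    and "\<And>t. f (t + T) = f t"
    and "integral {0..T} f = 0"
    and "\<bar>2 * of_int N * pi / T\<bar> < 1"
  shows "\<exists>x y. is_solution a f x \<and> winding_periodic T N x \<and>
               is_solution a f y \<and> winding_periodic T N y \<and>
               \<not> (\<exists>k::int. \<forall>t. x t - y t = 2 * of_int k * pi) \<and>
               (unstable_solution a f T N x \<or> unstable_solution a f T N y)"
proof -
  obtain Bf where Bf: "\<And>t. \<bar>f t\<bar> \<le> Bf"
    using periodic_continuous_bounded[OF assms(3,4,2)] by blast
  obtain F where F: "\<And>t. (F has_real_derivative f t) (at t)"
    using antiderivative_exists[OF assms(3)]
    by (auto simp: has_real_derivative_iff_has_vector_derivative)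
  have F_per: "F (t + T) = F t" for t
  proof -
    have "((\<lambda>t. F (t + T) - F t) has_real_derivative f (t + T) * 1 - f t) (at t)" for t
      by (intro DERIV_diff F DERIV_chain2[OF F]) (auto intro!: derivative_eq_intros)
    then have "\<forall>t. ((\<lambda>t. F (t + T) - F t) has_real_derivative 0) (at t)" using assms(4) by simp
    from DERIV_isconst_all[OF this, of t 0] have "F (t + T) - F t = F T - F 0" by simp
    moreover have "(f has_integral F T - F 0) {0..T}"
      using F \<open>T > 0\<close>
      by (intro fundamental_theorem_of_calculus)
        (auto simp: has_real_derivative_iff_has_vector_derivative has_vector_derivative_at_within)
    then have "F T - F 0 = 0" using assms(5) by (simp add: integral_unique)
    ultimately show ?thesis by simp
  qed
  have "continuous_on UNIV F"
    using F DERIV_isCont continuous_at_imp_continuous_on by blast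
  then obtain BF where BF: "\<And>t. \<bar>F t\<bar> \<le> BF"
    using periodic_continuous_bounded[of F T] F_per \<open>T > 0\<close> by blast

  interpret R: relativistic_system a f Bf T N
    by unfold_locales (simp_all add: assms(1-4) Bf velocity_lipschitz velocity_def[of 0])

  \<comment> \<open>The speed \<open>v\<close> lies strictly between the mean speed \<open>w\<close> and the limit speed \<open>1\<close>, and \<open>P\<close> is its
      momentum. Over \<open>j\<close> periods an advance by the mean speed plus one extra turn is still slower
      than \<open>v\<close>, so \<open>M\<close> bounds the momentum of every solution that is used below.\<close>
  define w where "w = \<bar>2 * of_int N * pi / T\<bar>"
  define v where "v = (1 + w) / 2"
  have "0 \<le> w" "w < 1" using assms(6) unfolding w_def by simp_all
  then have w: "0 \<le> w" "w < v" "v < 1" "0 \<le> v" by (simp_all add: v_def)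
  define P where "P = v / sqrt (1 - v\<^sup>2)"
  have vP: "velocity P = v" unfolding P_def by (rule velocity_surj[OF w(4,3)])
  have P0: "0 \<le> P"
    unfolding P_def using w by (simp add: abs_square_le_1)
  have wT: "w * T = 2 * pi * \<bar>of_int N\<bar>" using \<open>T > 0\<close> by (simp add: w_def abs_mult)
  obtain j :: nat where j: "2 * pi / (T * (v - w)) < j" using reals_Archimedean2 by blast
  have Tvw: "T * (v - w) > 0" using \<open>T > 0\<close> w by simp
  have jpos: "j > 0"
  proof -
    have "0 < 2 * pi / (T * (v - w))" using Tvw by simp
    then show ?thesis using j by (cases j) auto
  qed
  define L where "L = of_nat j * T"
  have L: "L > 0" using jpos \<open>T > 0\<close> by (simp add: L_def)
  have slow: "2 * pi + 2 * pi * of_nat j * \<bar>of_int N\<bar> < v * L"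
  proof -
    have "2 * pi < of_nat j * (T * (v - w))" using j Tvw by (simp add: pos_divide_less_eq)
    then have "2 * pi + of_nat j * (w * T) < v * L" by (simp add: L_def algebra_simps)
    then show ?thesis unfolding wT by (simp add: algebra_simps)
  qed
  define M where "M = P + (a + Bf) * L"
  have Bf0: "Bf \<ge> 0" using Bf[of 0] by linarith
  have PM: "P \<le> M" unfolding M_def using \<open>a > 0\<close> L Bf0 by simp
  have M0: "M \<ge> 0" using PM P0 by linarith
  have fast: "\<bar>cut_velocity M p\<bar> > v" if "\<bar>p\<bar> > P" for p
    using cut_velocity_fast[OF P0 PM that] by (simp only: vP)
  have fast': "\<bar>velocity p\<bar> > v" if "\<bar>p\<bar> > P" for p
    using velocity_fast[OF P0 that] by (simp only: vP)

  have "continuous_on UNIV (cut_velocity M)"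
    by (rule lipschitz_on_continuous_on[of 1])
      (auto simp: lipschitz_on_def dist_real_def cut_velocity_lipschitz[OF M0])
  from antiderivative_exists[OF this]
  obtain \<Gamma> where \<Gamma>: "\<And>p. (\<Gamma> has_real_derivative cut_velocity M p) (at p)"
    by (auto simp: has_real_derivative_iff_has_vector_derivative)
  obtain \<nu> :: nat where \<nu>: "2 * T * (1 + a) < \<nu>" using reals_Archimedean2 by blast
  have \<nu>0: "\<nu> > 0"
  proof -
    have "0 < 2 * T * (1 + a)" using \<open>T > 0\<close> \<open>a > 0\<close> by simp
    then show ?thesis using \<nu> by (cases \<nu>) auto
  qed
  have short: "a * (T / real \<nu>)\<^sup>2 \<le> 1 / 4"
  proof -
    define s where "s = T / real \<nu>"
    have "s * (2 * (1 + a)) = (2 * T * (1 + a)) / real \<nu>" by (simp add: s_def)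
    also have "\<dots> \<le> 1" using \<nu> \<nu>0 by (subst pos_divide_le_eq) auto
    finally have s: "0 \<le> s" "s * (2 * (1 + a)) \<le> 1" using \<open>T > 0\<close> by (simp_all add: s_def)
    have "(s * (2 * (1 + a)))\<^sup>2 \<le> 1" using s \<open>a > 0\<close> by (intro power_le_one) auto
    moreover have "a \<le> (1 + a)\<^sup>2" using \<open>a > 0\<close> by (simp add: power2_eq_square algebra_simps)
    then have "a * s\<^sup>2 \<le> (1 + a)\<^sup>2 * s\<^sup>2" by (intro mult_right_mono) auto
    moreover have "(s * (2 * (1 + a)))\<^sup>2 = 4 * ((1 + a)\<^sup>2 * s\<^sup>2)"
      by (simp only: power_mult_distrib) simp
    ultimately show ?thesis unfolding s_def[symmetric] by linarith
  qed
  \<comment> \<open>The cut-off system coincides with the relativistic one for momenta up to \<open>M\<close>.\<close>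
  interpret C: twist_system a f "cut_velocity M" Bf F \<Gamma> "slope M" T BF \<nu>
  proof unfold_locales
    show "a > 0" "continuous_on UNIV f" "T > 0" "\<nu> > 0" "a * (T / real \<nu>)\<^sup>2 \<le> 1 / 4" "slope M > 0"
      by (rule assms \<nu>0 short slope_bounds)+
    show "\<bar>f t\<bar> \<le> Bf" "\<bar>F t\<bar> \<le> BF" "F (t + T) = F t" "f (t + T) = f t"
      "(F has_real_derivative f t) (at t)" "(\<Gamma> has_real_derivative cut_velocity M t) (at t)" for t
      by (rule Bf BF F_per assms F \<Gamma>)+
    show "cut_velocity M 0 = 0" using cut_velocity_eq[of 0 M] M0 by (simp add: velocity_def)
    show "\<bar>cut_velocity M Q - cut_velocity M p\<bar> \<le> \<bar>Q - p\<bar>" for p Q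
      by (rule cut_velocity_lipschitz[OF M0])
    show "slope M * (Q - p) \<le> cut_velocity M Q - cut_velocity M p" if "p \<le> Q" for p Q
      by (rule cut_velocity_increment(1)[OF that M0])
  qed

  have same: "C.field t z = R.field t z" if "\<bar>snd z\<bar> \<le> M" for t z
    using that by (simp add: C.field_def R.field_def cut_velocity_eq)
  have C_imp_R: "R.is_sol u" if "C.is_sol u" "\<And>t. \<bar>snd (u t)\<bar> \<le> M" for u
    using that same by (simp add: C.is_sol_def R.is_sol_def)
  have R_imp_C: "C.is_sol u" if "R.is_sol u" "\<And>t. \<bar>snd (u t)\<bar> \<le> M" for u
    using that same by (simp add: C.is_sol_def R.is_sol_def)
  have C_bound: "\<bar>snd (u t)\<bar> \<le> M"
    if u: "C.is_sol u"
      and adv: "\<And>i. \<bar>fst (u (C.node i + of_nat j * T)) - fst (u (C.node i)) - 2 * pi * of_nat j * of_int N\<bar> \<le> 2 * pi"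
    for u t
  proof -
    define i where "i = \<lfloor>t / C.\<tau>\<rfloor>"
    have "of_int i \<le> t / C.\<tau>" "t / C.\<tau> < of_int i + 1" unfolding i_def by linarith+
    then have "C.node i \<le> t" "t < C.node i + C.\<tau>"
      using C.\<tau>_pos by (simp_all add: C.node_def pos_le_divide_eq pos_divide_less_eq algebra_simps)
    moreover have "C.\<tau> \<le> L"
    proof -
      have "C.\<tau> \<le> T" using \<nu>0 \<open>T > 0\<close> by (simp add: C.\<tau>_def pos_divide_le_eq)
      also have "T \<le> L" using jpos \<open>T > 0\<close> by (simp add: L_def)
      finally show ?thesis .
    qed
    moreover have "\<bar>fst (u (C.node i + L)) - fst (u (C.node i))\<bar> < v * L"
    proof -
      have "\<bar>2 * pi * of_nat j * of_int N\<bar> = 2 * pi * of_nat j * \<bar>of_int N\<bar>" by (simp add: abs_mult)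
      then show ?thesis using adv[of i] slow unfolding L_def by linarith
    qed
    ultimately show ?thesis
      using C.momentum_bounded_if_slow[OF u L, where P = P and v = v and s = "C.node i" and t = t]
        fast by (simp add: M_def)
  qed

  have "\<exists>u. R.is_sol u \<and> \<bar>snd (u 0)\<bar> \<le> M \<and> 0 \<le> fst (u 0) \<and> fst (u 0) \<le> 2 * pi \<and>
      u (of_nat n * T) = u 0 + (2 * pi * (of_nat n * of_int N + 1), 0) \<and>
      norm (u T - (2 * pi * of_int N, 0) - u 0) \<le> (1 + C.K) * (2 * pi / of_nat n)"
    if "n \<ge> j" for n
  proof -
    have "n > 0" using that jpos by simp
    from C.drifting_solution_exists[OF this, of N] obtain u where u: "C.is_sol u"
      and u0: "0 \<le> fst (u 0)" "fst (u 0) \<le> 2 * pi"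
      and un: "u (of_nat n * T) = u 0 + (2 * pi * (of_nat n * of_int N + 1), 0)"
      and adv: "\<And>i k. k \<le> n \<Longrightarrow> \<bar>fst (u (C.node i + of_nat k * T)) - fst (u (C.node i)) - 2 * pi * of_nat k * of_int N\<bar> \<le> 2 * pi"
      and close: "norm (u T - (2 * pi * of_int N, 0) - u 0) \<le> (1 + C.K) * (2 * pi / of_nat n)"
      by blast
    have bd: "\<bar>snd (u t)\<bar> \<le> M" for t by (rule C_bound[OF u adv[OF that]])
    show ?thesis
      using C_imp_R[OF u bd] bd u0 un close by blast
  qed
  then have "\<forall>n. \<exists>u. n \<ge> j \<longrightarrow> R.is_sol u \<and> \<bar>snd (u 0)\<bar> \<le> M \<and> 0 \<le> fst (u 0) \<and> fst (u 0) \<le> 2 * pi \<and>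
      u (of_nat n * T) = u 0 + (2 * pi * (of_nat n * of_int N + 1), 0) \<and>
      norm (u T - (2 * pi * of_int N, 0) - u 0) \<le> (1 + C.K) * (2 * pi / of_nat n)"
    by blast
  from choice[OF this] obtain U where "\<forall>n. n \<ge> j \<longrightarrow> R.is_sol (U n) \<and> \<bar>snd (U n 0)\<bar> \<le> M \<and>
      0 \<le> fst (U n 0) \<and> fst (U n 0) \<le> 2 * pi \<and>
      U n (of_nat n * T) = U n 0 + (2 * pi * (of_nat n * of_int N + 1), 0) \<and>
      norm (U n T - (2 * pi * of_int N, 0) - U n 0) \<le> (1 + C.K) * (2 * pi / of_nat n)"
    by blast
  then have U_sol: "R.is_sol (U n)" and U_p: "\<bar>snd (U n 0)\<bar> \<le> M"
    and U_q: "0 \<le> fst (U n 0)" "fst (U n 0) \<le> 2 * pi"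
    and U_n: "U n (of_nat n * T) = U n 0 + (2 * pi * (of_nat n * of_int N + 1), 0)"
    and U_close: "norm (U n T - (2 * pi * of_int N, 0) - U n 0) \<le> (1 + C.K) * (2 * pi / of_nat n)"
    if "n \<ge> j" for n
    using that by blast+
  let ?P = "poincare_map a f T N"
  define z where "z k = U (k + j) 0" for k
  have "z k \<in> cbox (0, - M) (2 * pi, M)" for k
    using U_p[of "k + j"] U_q[of "k + j"] by (auto simp: z_def mem_box Basis_prod_def inner_prod_def)
  then obtain l r where r: "strict_mono (r :: nat \<Rightarrow> nat)" and lim: "(z \<circ> r) \<longlonglongrightarrow> l"
    using compact_cbox[of "(0, - M)" "(2 * pi, M)"] unfolding compact_def by metis
  have lim': "(\<lambda>k. z (r k)) \<longlonglongrightarrow> l" using lim by (simp add: o_def)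
  have Pz: "?P (z k) = U (k + j) T - (2 * pi * of_int N, 0)" for k
    unfolding z_def by (rule R.poincare_map_sol[OF U_sol]) simp
  have "(\<lambda>k. ?P (z k) - z k) \<longlonglongrightarrow> 0"
  proof (rule Lim_null_comparison)
    show "\<forall>\<^sub>F k in sequentially. norm (?P (z k) - z k) \<le> (1 + C.K) * (2 * pi / of_nat (k + j))"
    proof (intro always_eventually allI)
      show "norm (?P (z k) - z k) \<le> (1 + C.K) * (2 * pi / of_nat (k + j))" for k
        unfolding Pz unfolding z_def by (rule U_close) simp
    qed
    have "(\<lambda>k. 2 * pi / real (k + j)) \<longlonglongrightarrow> 0"
      by (rule LIMSEQ_ignore_initial_segment) (rule lim_const_over_n)
    then show "(\<lambda>k. (1 + C.K) * (2 * pi / of_nat (k + j))) \<longlonglongrightarrow> 0" by (rule tendsto_mult_right_zero)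
  qed
  from LIMSEQ_subseq_LIMSEQ[OF this r]
  have "(\<lambda>k. ?P (z (r k)) - z (r k)) \<longlonglongrightarrow> 0" by (simp add: o_def)
  moreover have "(\<lambda>k. ?P (z (r k)) - z (r k)) \<longlonglongrightarrow> ?P l - l"
    by (intro tendsto_diff R.poincare_map_tendsto lim')
  ultimately have fp: "?P l = l" using LIMSEQ_unique by fastforce
  have unstable: "unstable_fixed_point UNIV ?P l"
  proof (rule R.unstable_if_drifting_orbits_accumulate[OF lim' fp])
    show "0 < r k + j" for k using jpos by simp
    show "(?P ^^ (r k + j)) (z (r k)) = z (r k) + (2 * pi, 0)" for k
      unfolding z_def using R.poincare_map_pow_sol[OF U_sol[of "r k + j"], of "r k + j"] U_n[of "r k + j"]
      by (simp add: prod_eq_iff algebra_simps)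
  qed

  define u where "u = trajectory a f l"
  have u: "R.is_sol u" and u0: "u 0 = l"
    unfolding u_def by (rule R.trajectory_sol R.trajectory_start)+
  have uT: "u (t + T) = u t + (2 * pi * of_int N, 0)" for t
    using R.fixed_point_winding[OF u] fp u0 by simp
  have uk: "u (t + of_nat k * T) = u t + (2 * pi * of_nat k * of_int N, 0)" for t k
  proof (induction k)
    case (Suc k)
    have "u (t + of_nat (Suc k) * T) = u ((t + of_nat k * T) + T)" by (simp add: algebra_simps)
    then show ?case unfolding uT Suc by (simp add: prod_eq_iff algebra_simps)
  qed (simp add: zero_prod_def[symmetric])
  have u_bd: "\<bar>snd (u t)\<bar> \<le> M" for t
  proof -
    have "\<bar>fst (u (t + L)) - fst (u t)\<bar> < v * L"
    proof -
      have "2 * pi * of_nat j * \<bar>of_int N\<bar> < v * L" using slow pi_gt_zero by linarith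
      then show ?thesis unfolding L_def uk by (simp add: abs_mult)
    qed
    from R.momentum_bounded_if_slow[OF u L fast' this] show ?thesis using L by (simp add: M_def)
  qed
  have uC: "C.is_sol u" by (rule R_imp_C[OF u u_bd])

  let ?q = "\<lambda>i. fst (u (C.node i))"
  have wq: "C.winding 1 N ?q" unfolding C.solution_winding_iff[OF uC] by (simp add: uT)
  have gq: "C.G ?q i = 0" for i by (rule C.solution_gives_critical[OF uC])
  \<comment> \<open>The fixed point found so far gives the critical sequence to start from; a second one differs
      from it by more than a translation and is again slow enough to solve the relativistic system.\<close>
  from C.second_critical_exists[OF wq zero_less_one gq]
  obtain Q where wQ: "C.winding 1 N Q" and gQ: "\<And>i. C.G Q i = 0"
    and new: "\<And>k. Q \<noteq> C.trans 0 k ?q" by blast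
  obtain y where yC: "C.is_sol y" and y_node: "\<And>i. y (C.node i) = (Q i, C.Y i (Q i) (Q (i + 1)))"
    using C.critical_gives_solution[OF gQ] by blast
  have "C.winding 1 N (\<lambda>i. fst (y (C.node i)))" using wQ by (simp add: y_node)
  then have yT: "y (t + T) = y t + (2 * pi * of_int N, 0)" for t
    using C.solution_winding_iff[OF yC, of 1 N] by simp
  have yk: "y (t + of_nat k * T) = y t + (2 * pi * of_nat k * of_int N, 0)" for t k
  proof (induction k)
    case (Suc k)
    have "y (t + of_nat (Suc k) * T) = y ((t + of_nat k * T) + T)" by (simp add: algebra_simps)
    then show ?case unfolding yT Suc by (simp add: prod_eq_iff algebra_simps)
  qed (simp add: zero_prod_def[symmetric])
  have y: "R.is_sol y"
    by (rule C_imp_R[OF yC], rule C_bound[OF yC]) (simp add: yk)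

  show ?thesis
  proof (intro exI conjI)
    show "is_solution a f (\<lambda>t. fst (u t))" "is_solution a f (\<lambda>t. fst (y t))"
      by (rule R.position_is_solution[OF u] R.position_is_solution[OF y])+
    show "winding_periodic T N (\<lambda>t. fst (u t))" "winding_periodic T N (\<lambda>t. fst (y t))"
      by (simp_all add: winding_periodic_def uT yT)
    show "\<not> (\<exists>k::int. \<forall>t. fst (u t) - fst (y t) = 2 * of_int k * pi)"
    proof
      assume "\<exists>k::int. \<forall>t. fst (u t) - fst (y t) = 2 * of_int k * pi"
      then obtain k :: int where k: "\<And>t. fst (u t) - fst (y t) = 2 * of_int k * pi" by blast
      have "Q i = C.trans 0 (- k) ?q i" for i
        using k[of "C.node i"] by (simp add: y_node C.trans_def algebra_simps)
      then show False using new[of "- k"] by (simp add: fun_eq_iff)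
    qed
    show "unstable_solution a f T N (\<lambda>t. fst (u t)) \<or> unstable_solution a f T N (\<lambda>t. fst (y t))"
      using unstable by (simp add: unstable_solution_def R.momentum_position[OF u] u0)
  qed
qed

end
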